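(* For any multi-index $\boldsymbol{\alpha}=(\alpha_1,\ldots,\alpha_s)$ and any integer $k\ge 1$, $$\sum_{\substack{k_1+\cdots+k_s=k\\ k_1\ge 1,\ k_2,\ldots,k_s\ge 0}}\zeta_{\boldsymbol{\alpha}}(\underbrace{k_1+1,1,\ldots,1}_{\alpha_1},\ldots,\underbrace{k_s+1,1,\ldots,1}_{\alpha_s})=\zeta\bigl(d(\boldsymbol{\alpha}^{\tau})\circledast(\underbrace{1,\ldots,1}_{k})\bigr),$$ where the sum is over integers $k_1,\ldots,k_s$.
   Context: A multi-index is a finite (nonempty) sequence $\boldsymbol{\alpha}=(\alpha_1,\ldots,\alpha_s)$ of positive integers, with length $l(\boldsymbol{\alpha})=s$ and weight $|\boldsymbol{\alpha}|=\alpha_1+\cdots+\alpha_s$; $\boldsymbol{\alpha}^{\tau}=(\alpha_s,\ldots,\alpha_1)$. A multi-index is admissible if its first entry is at least $2$. Let $I$ be the set of multi-indices, ${}^{+}I$ the set of admissible ones, and $V$, ${}^{+}V$ the $\mathbb{Q}$-vector spaces with bases $I$, ${}^{+}I$. The $\mathbb{Q}$-linear map $d:V\to V$ is given by $d(\boldsymbol{\alpha})=\sum_{\boldsymbol{\beta}\le\boldsymbol{\alpha}}\boldsymbol{\beta}$, where $\boldsymbol{\beta}\le\boldsymbol{\alpha}$ means that $\boldsymbol{\alpha}$ is a refinement of $\boldsymbol{\beta}$, i.e. $\boldsymbol{\beta}$ is obtained from $\boldsymbol{\alpha}$ by adding together groups of consecutive entries (possibly trivially). For example $d(1,2,3)=(1,2,3)+(3,3)+(1,5)+(6)$.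 The $\mathbb{Q}$-bilinear map $\circledast:V\times V\to{}^{+}V$ is given on multi-indices $\boldsymbol{\alpha}=(\alpha_1,\ldots,\alpha_s)$, $\boldsymbol{\beta}=(\beta_1,\ldots,\beta_t)$ by $$\boldsymbol{\alpha}\circledast\boldsymbol{\beta}=(\alpha_1+\beta_1)\,\#\,\bigl((\alpha_2,\ldots,\alpha_s)*(\beta_2,\ldots,\beta_t)\bigr),$$ where $\#$ is concatenation (extended bilinearly) and $*$ is the harmonic (stuffle) product: it is bilinear on the space spanned by all finite sequences of positive integers including the empty sequence $\emptyset$, $\emptyset*w=w*\emptyset=w$, and for $a,b\ge1$ and sequences $u,v$: $(a\#u)*(b\#v)=a\#(u*(b\#v))+b\#((a\#u)*v)+(a+b)\#(u*v)$. For example $(\alpha_1,\alpha_2)\circledast(\beta_1)=(\alpha_1+\beta_1,\alpha_2)$. For a multi-index $\boldsymbol{\alpha}=(\alpha_1,\ldots,\alpha_s)$ and an admissible multi-index $\boldsymbol{\mu}$ with $l(\boldsymbol{\mu})=|\boldsymbol{\alpha}|$, written in consecutive blocks as $\boldsymbol{\mu}=(\mu_{1,1},\ldots,\mu_{1,\alpha_1},\ldots,\mu_{s,1},\ldots,\mu_{s,\alpha_s})$, $$\zeta_{\boldsymbol{\alpha}}(\boldsymbol{\mu})=\sum\prod_{i=1}^{s}\prod_{j=1}^{\alpha_i}\frac{1}{m_{i,j}^{\mu_{i,j}}},$$ summed over all positive integers $m_{i,j}$ ($1\le i\le s$, $1\le j\le\alpha_i$) with $m_{i,1}>\cdots>m_{i,\alpha_i}$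 for each $i$ and $m_{i,\alpha_i}\ge m_{i+1,1}$ for $1\le i\le s-1$. For an admissible $\boldsymbol{\mu}=(\mu_1,\ldots,\mu_p)$, $\zeta(\boldsymbol{\mu})=\zeta_{(p)}(\boldsymbol{\mu})=\sum_{n_1>\cdots>n_p>0}n_1^{-\mu_1}\cdots n_p^{-\mu_p}$ is the usual multiple zeta value, and $\zeta$ is extended $\mathbb{Q}$-linearly to ${}^{+}V$. *)

theory Defs
  imports "HOL-Analysis.Analysis" "HOL-Library.Poly_Mapping"
begin

definition multi_index :: "nat list \<Rightarrow> bool" where
  "multi_index w \<longleftrightarrow> w \<noteq> [] \<and> (\<forall>a\<in>set w. a \<ge> 1)"

definition admissible :: "nat list \<Rightarrow> bool" where
  "admissible w \<longleftrightarrow> multi_index w \<and> hd w \<ge> 2"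

text \<open>
  Formal rational combinations of finite sequences are finitely supported functions; the spaces
  with bases the multi-indices and the admissible multi-indices are carved out by the support.
  The linear maps below are defined on all of \<open>nat list \<Rightarrow>\<^sub>0 rat\<close>, and are meaningful on the
  respective subspaces.
\<close>

type_synonym lincomb = "nat list \<Rightarrow>\<^sub>0 rat"

definition V :: "lincomb set" where
  "V = {x. \<forall>w\<in>Poly_Mapping.keys x. multi_index w}"

definition V_adm :: "lincomb set" where
  "V_adm = {x. \<forall>w\<in>Poly_Mapping.keys x. admissible w}"

abbreviation basis :: "nat list \<Rightarrow> lincomb" where
  "basis w \<equiv> Poly_Mapping.single w 1"

definition scl :: "rat \<Rightarrow> lincomb \<Rightarrow> lincomb" where
  "scl c x = Poly_Mapping.map ((*) c) x"

definition lin_ext :: "(nat list \<Rightarrow> lincomb) \<Rightarrow> lincomb \<Rightarrow> lincomb" where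
  "lin_ext f x = (\<Sum>w\<in>Poly_Mapping.keys x. scl (Poly_Mapping.lookup x w) (f w))"

definition bilin_ext :: "(nat list \<Rightarrow> nat list \<Rightarrow> lincomb) \<Rightarrow> lincomb \<Rightarrow> lincomb \<Rightarrow> lincomb" where
  "bilin_ext f x y = lin_ext (\<lambda>u. lin_ext (f u) y) x"

definition coarser :: "nat list \<Rightarrow> nat list \<Rightarrow> bool" where
  "coarser \<beta> \<alpha> \<longleftrightarrow> (\<exists>groups. concat groups = \<alpha> \<and> [] \<notin> set groups \<and> map sum_list groups = \<beta>)"

text \<open>
  Different groupings of a multi-index have different partial sums, so summing over the set of
  coarser sequences loses no multiplicities.
\<close>

definition d_map :: "lincomb \<Rightarrow> lincomb" where
  "d_map = lin_ext (\<lambda>\<alpha>. \<Sum>\<beta> | coarser \<beta> \<alpha>. basis \<beta>)"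

definition prepend :: "nat \<Rightarrow> lincomb \<Rightarrow> lincomb" where
  "prepend a = lin_ext (\<lambda>w. basis (a # w))"

fun stuffle :: "nat list \<Rightarrow> nat list \<Rightarrow> lincomb" where
  "stuffle [] w = basis w"
| "stuffle (a # u) [] = basis (a # u)"
| "stuffle (a # u) (b # v) =
     prepend a (stuffle u (b # v)) + prepend b (stuffle (a # u) v) + prepend (a + b) (stuffle u v)"

fun circ_stuffle :: "nat list \<Rightarrow> nat list \<Rightarrow> lincomb" where
  "circ_stuffle (a # u) (b # v) = prepend (a + b) (stuffle u v)"
| "circ_stuffle _ _ = 0" \<comment> \<open>junk: multi-indices are nonempty\<close>

definition circledast :: "lincomb \<Rightarrow> lincomb \<Rightarrow> lincomb"  (infixl \<open>\<circledast>\<close> 70) where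
  "x \<circledast> y = bilin_ext circ_stuffle x y"

text \<open>
  A summation index of \<open>\<zeta>\<^sub>\<alpha>\<close> is a list of blocks: \<open>m ! i ! j\<close> is the \<open>j\<close>-th entry of the \<open>i\<close>-th
  block (both counted from 0), and the exponent belonging to it sits at position
  \<open>sum_list (take i \<alpha>) + j\<close> of the flat list \<open>\<mu>\<close>. For multi-indices \<open>\<alpha>\<close> and admissible \<open>\<mu>\<close> the
  series converges, so the default value 0 of a divergent sum plays no role there.
\<close>

definition zeta_indices :: "nat list \<Rightarrow> nat list list set" where
  "zeta_indices \<alpha> = {m. map length m = \<alpha>
      \<and> (\<forall>b\<in>set m. sorted_wrt (>) b \<and> (\<forall>n\<in>set b. n > 0))
      \<and> (\<forall>i. Suc i < length m \<longrightarrow> last (m ! i) \<ge> hd (m ! Suc i))}"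

definition zeta_multi :: "nat list \<Rightarrow> nat list \<Rightarrow> real" where
  "zeta_multi \<alpha> \<mu> = (\<Sum>\<^sub>\<infinity>m\<in>zeta_indices \<alpha>.
     \<Prod>i<length \<alpha>. \<Prod>j<\<alpha> ! i. 1 / real (m ! i ! j) ^ (\<mu> ! (sum_list (take i \<alpha>) + j)))"

definition mzv :: "nat list \<Rightarrow> real" where
  "mzv \<mu> = (\<Sum>\<^sub>\<infinity>n | length n = length \<mu> \<and> sorted_wrt (>) n \<and> (\<forall>x\<in>set n. x > 0).
     \<Prod>i<length \<mu>. 1 / real (n ! i) ^ (\<mu> ! i))"

definition zeta :: "lincomb \<Rightarrow> real" where
  "zeta x = (\<Sum>w\<in>Poly_Mapping.keys x. of_rat (Poly_Mapping.lookup x w) * mzv w)"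

lemma mzv_eq_zeta_multi: "mzv \<mu> = zeta_multi [length \<mu>] \<mu>"
proof -
  let ?N = "{n::nat list. length n = length \<mu> \<and> sorted_wrt (>) n \<and> (\<forall>x\<in>set n. x > 0)}"
  have *: "zeta_indices [length \<mu>] = (\<lambda>n. [n]) ` ?N"
    by (auto simp: zeta_indices_def image_iff map_eq_Cons_conv)
  show ?thesis
    unfolding mzv_def zeta_multi_def *
    by (subst infsum_reindex) (auto simp: inj_on_def o_def)
qed

lemma keys_scl: "Poly_Mapping.keys (scl c x) \<subseteq> Poly_Mapping.keys x"
  by (auto simp: scl_def in_keys_iff Poly_Mapping.map.rep_eq when_def)

lemma in_keys_sumE:
  assumes "w \<in> Poly_Mapping.keys (sum f A)"
  obtains i where "i \<in> A" "w \<in> Poly_Mapping.keys (f i)"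
  using subsetD[OF keys_sum assms] by blast

lemma in_keys_lin_extE:
  assumes "w \<in> Poly_Mapping.keys (lin_ext f x)"
  obtains u where "u \<in> Poly_Mapping.keys x" "w \<in> Poly_Mapping.keys (f u)"
  using assms unfolding lin_ext_def by (elim in_keys_sumE) (use keys_scl in blast)

lemma in_keys_prependE:
  assumes "w \<in> Poly_Mapping.keys (prepend a x)"
  obtains u where "u \<in> Poly_Mapping.keys x" "w = a # u"
  using assms unfolding prepend_def by (elim in_keys_lin_extE) simp

lemma keys_stuffle_pos:
  assumes "\<forall>a\<in>set u. a \<ge> 1" "\<forall>a\<in>set v. a \<ge> 1" "w \<in> Poly_Mapping.keys (stuffle u v)"
  shows "\<forall>a\<in>set w. a \<ge> 1"
  using assms
proof (induction u v arbitrary: w rule: stuffle.induct)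
  case (3 a u b v)
  have "w \<in> Poly_Mapping.keys (prepend a (stuffle u (b # v)))
      \<union> Poly_Mapping.keys (prepend b (stuffle (a # u) v))
      \<union> Poly_Mapping.keys (prepend (a + b) (stuffle u v))"
    using "3.prems"(3) unfolding stuffle.simps
    by (meson Poly_Mapping.keys_add Un_mono order_refl subsetD subset_trans)
  then consider
      w' where "w' \<in> Poly_Mapping.keys (stuffle u (b # v))" "w = a # w'"
    | w' where "w' \<in> Poly_Mapping.keys (stuffle (a # u) v)" "w = b # w'"
    | w' where "w' \<in> Poly_Mapping.keys (stuffle u v)" "w = (a + b) # w'"
    by (elim UnE in_keys_prependE)
  then show ?case
  proof cases
    case (1 w')
    have "\<forall>c\<in>set w'. c \<ge> 1" by (rule "3.IH"(1)) (use "3.prems" 1 in auto)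
    then show ?thesis using "3.prems"(1) 1 by simp
  next
    case (2 w')
    have "\<forall>c\<in>set w'. c \<ge> 1" by (rule "3.IH"(2)) (use "3.prems" 2 in auto)
    then show ?thesis using "3.prems"(2) 2 by simp
  next
    case (3 w')
    have "\<forall>c\<in>set w'. c \<ge> 1" by (rule "3.IH"(3)) (use "3.prems" 3 in auto)
    then show ?thesis using "3.prems"(1) 3 by simp
  qed
qed auto

lemma multi_index_coarser:
  assumes "multi_index \<alpha>" "coarser \<beta> \<alpha>"
  shows "multi_index \<beta>"
proof -
  obtain g where g: "concat g = \<alpha>" "[] \<notin> set g" "map sum_list g = \<beta>"
    using assms(2) by (auto simp: coarser_def)
  have "sum_list b \<ge> 1" if b: "b \<in> set g" for b
  proof -
    have "b \<noteq> []" using b g(2) by auto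
    then have h: "hd b \<in> set b" by simp
    then have "hd b \<in> set \<alpha>" using g(1) b by auto
    then have "hd b \<ge> 1" using assms(1) by (simp add: multi_index_def)
    then show ?thesis using member_le_sum_list[OF h] by linarith
  qed
  then show ?thesis using assms(1) g by (auto simp: multi_index_def)
qed

lemma d_map_in_V:
  assumes "x \<in> V"
  shows "d_map x \<in> V"
proof -
  have "multi_index w" if w: "w \<in> Poly_Mapping.keys (d_map x)" for w
  proof -
    obtain u where u: "u \<in> Poly_Mapping.keys x"
      "w \<in> Poly_Mapping.keys (\<Sum>\<beta> | coarser \<beta> u. basis \<beta>)"
      using w unfolding d_map_def by (rule in_keys_lin_extE)
    from u(2) have "coarser w u" by (rule in_keys_sumE) simp
    then show ?thesis using u(1) assms multi_index_coarser by (auto simp: V_def)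
  qed
  then show ?thesis by (simp add: V_def)
qed

lemma circledast_in_V_adm:
  assumes "x \<in> V" "y \<in> V"
  shows "x \<circledast> y \<in> V_adm"
proof -
  have "admissible w" if w: "w \<in> Poly_Mapping.keys (x \<circledast> y)" for w
  proof -
    obtain p where p: "p \<in> Poly_Mapping.keys x"
      "w \<in> Poly_Mapping.keys (lin_ext (circ_stuffle p) y)"
      using w unfolding circledast_def bilin_ext_def by (rule in_keys_lin_extE)
    obtain q where q: "q \<in> Poly_Mapping.keys y" "w \<in> Poly_Mapping.keys (circ_stuffle p q)"
      using p(2) by (rule in_keys_lin_extE)
    have m: "multi_index p" "multi_index q" using p q assms by (auto simp: V_def)
    then obtain a u b v where e: "p = a # u" "q = b # v"
      by (cases p; cases q) (auto simp: multi_index_def)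
    obtain w' where w': "w' \<in> Poly_Mapping.keys (stuffle u v)" "w = (a + b) # w'"
      using q(2) unfolding e circ_stuffle.simps by (rule in_keys_prependE)
    have "\<forall>c\<in>set w'. c \<ge> 1"
      by (rule keys_stuffle_pos[OF _ _ w'(1)]) (use m e in \<open>auto simp: multi_index_def\<close>)
    then show ?thesis using m e w'(2) by (auto simp: admissible_def multi_index_def)
  qed
  then show ?thesis by (simp add: V_adm_def)
qed

end

theory Submission
  imports Defs "HOL-Real_Asymp.Real_Asymp"
begin

text \<open>
  The proof is a connected-sum argument. Let \<open>e\<^sub>k(N)\<close> (\<open>rising_coeff k N\<close>) be the coefficient of
  \<open>x\<^sup>k\<close> in \<open>x(x+1)\<dots>(x+N-1)/N!\<close>; for \<open>k \<ge> 1\<close> it is \<open>1/N\<close> times the sum of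
  \<open>1/(n\<^sub>2\<dots>n\<^sub>k)\<close> over \<open>N > n\<^sub>2 > \<dots> > n\<^sub>k > 0\<close>.

  Right-hand side. The coarsenings of \<open>\<alpha>\<^sup>\<tau>\<close> turn strict inequalities into weak ones, and truncated
  multiple harmonic sums are multiplicative for the harmonic product. Since \<open>\<circledast>\<close> fuses the two
  leading entries, both factors share their largest index, and the right-hand side becomes
  the sum of \<open>e\<^sub>k(N\<^sub>s)\<close> times the product of all \<open>1 / N\<^sub>i ^ \<alpha>\<^sub>i\<close> over \<open>1 \<le> N\<^sub>1 \<le> \<dots> \<le> N\<^sub>s\<close>
  (\<open>sums_zeta_d_map_circledast\<close>).

  Left-hand side. Take \<open>C(p,N) = p! N!/(p+N)!\<close> (\<open>conn p N\<close>) as a connector between the summation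
  variables of the two sides. Two telescoping sums drive everything:
  \<open>\<Sum>\<^bsub>n>p\<^esub> C(n,N) / n = C(p,N) / N\<close> for \<open>N \<ge> 1\<close> and, for \<open>b, M \<ge> 1\<close>,
  \<open>\<Sum>\<^bsub>c\<le>k\<^esub> e\<^bsub>k-c\<^esub>(M) C(b-1,M) / b ^ c = \<Sum>\<^bsub>N\<ge>M\<^esub> e\<^sub>k(N) C(b,N)\<close>.
  The blocks of a chain are removed starting from the one with the largest entries. The sum over the
  extra exponent \<open>c\<close> of the first entry \<open>b\<close> of a block is traded by the second identity for a new,
  weakly larger variable \<open>N\<close>; the entries of the block are then summed away from the top by the first
  identity, each leaving a factor \<open>1/N\<close>, so that a block of length \<open>\<alpha>\<^sub>i\<close> leaves \<open>1 / N ^ \<alpha>\<^sub>i\<close>. The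
  last entry of the block must be at least the first entry \<open>b\<close> of the next one, that is, greater than
  \<open>b - 1\<close>; hence the connector that remains is \<open>C(b-1,N)\<close>, with which the next round starts.
  The start is \<open>M = 1\<close>: there \<open>e\<^sub>j(1)\<close> vanishes unless \<open>j = 1\<close> and \<open>C(b-1,1) = 1/b\<close>, which
  turns the sum over all \<open>k\<^sub>1 \<ge> 0\<close> of total \<open>k - 1\<close> into the required sum with \<open>k\<^sub>1 \<ge> 1\<close> of total
  \<open>k\<close>. After the last block \<open>C(0,N) = 1\<close> remains, and the sum over the \<open>N\<^sub>i\<close> above
  (\<open>connected_sum_transport\<close>).

  All terms are nonnegative, so the interchanges are done in the extended nonnegative reals;
  convergence of the final series gives convergence of every series on the left afterwards.
\<close>

(* Let an unbounded sum over a natural index denote the series rather than the sum over a finite support. *)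
no_syntax
  "_Sum_any" :: "pttrn \<Rightarrow> 'a \<Rightarrow> 'a::comm_monoid_add"    (\<open>(\<open>indent=2 notation=\<open>binder \<Sum>\<close>\<close>\<Sum>_. _)\<close> [0, 10] 10)

section \<open>Growth of multiple harmonic sums\<close>

text \<open>
  The summation index \<open>0\<close> contributes nothing for positive exponents because
  \<open>1 / 0 ^ a = 0\<close> for \<open>a \<ge> 1\<close>.
\<close>

fun mhs :: "nat list \<Rightarrow> nat \<Rightarrow> real" where
  "mhs [] N = 1"
| "mhs (a # w) N = (\<Sum>n<N. mhs w n / real n ^ a)"

lemma mhs_nonneg: "0 \<le> mhs w N"
  by (induction w N rule: mhs.induct) (auto intro!: sum_nonneg)

lemma sum_inverse_le_ln:
  assumes "n \<ge> 1"
  shows "(\<Sum>m<Suc n. 1 / real m) \<le> 1 + ln (real n)"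
  using assms
proof (induction n rule: dec_induct)
  case (step n)
  have "ln (real n / real (Suc n)) \<le> real n / real (Suc n) - 1"
    using step by (intro ln_le_minus_one) auto
  also have "\<dots> = - (1 / real (Suc n))" by (simp add: field_simps)
  finally have "1 / real (Suc n) \<le> ln (real (Suc n)) - ln (real n)"
    using step by (simp add: ln_div)
  with step.IH show ?case by simp
qed auto

text \<open>
  Dropping the order constraint on the indices and lowering every exponent to \<open>1\<close> only increases
  the sum.
\<close>

lemma mhs_le_power: "mhs w n \<le> (\<Sum>m<n. 1 / real m) ^ length w" if "\<forall>a\<in>set w. a \<ge> 1"
  using that
proof (induction w arbitrary: n)
  case (Cons a w)
  have "mhs w m / real m ^ a \<le> (\<Sum>m<n. 1 / real m) ^ length w * (1 / real m)" if "m < n" for m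
  proof (cases "m = 0")
    case True then show ?thesis using Cons.prems by (simp add: zero_power)
  next
    case False
    have "mhs w m \<le> (\<Sum>m<m. 1 / real m) ^ length w" using Cons by auto
    also have "\<dots> \<le> (\<Sum>m<n. 1 / real m) ^ length w"
      using that by (intro power_mono sum_mono2 sum_nonneg) auto
    finally have 1: "mhs w m \<le> (\<Sum>m<n. 1 / real m) ^ length w" .
    have 2: "1 / real m ^ a \<le> 1 / real m"
      using Cons.prems False by (intro divide_left_mono self_le_power) auto
    have "mhs w m * (1 / real m ^ a) \<le> (\<Sum>m<n. 1 / real m) ^ length w * (1 / real m)"
      using 1 2 by (intro mult_mono) (auto intro!: sum_nonneg zero_le_power)
    then show ?thesis by simp
  qed
  then have "mhs (a # w) n \<le> (\<Sum>m<n. (\<Sum>m<n. 1 / real m) ^ length w * (1 / real m))"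
    by (auto intro!: sum_mono)
  also have "\<dots> = (\<Sum>m<n. 1 / real m) ^ length (a # w)"
    by (simp add: sum_distrib_left sum_distrib_right)
  finally show ?case .
qed simp

text \<open>
  The true growth is at most a power of the logarithm; any bound by a power of \<open>n\<close> with exponent
  below \<open>1\<close> serves both for summability at leading exponent \<open>2\<close> and for the decay of the
  boundary terms of the telescoping sums.
\<close>

lemma mhs_bigo:
  assumes "\<forall>a\<in>set w. a \<ge> 1"
  shows "mhs w \<in> O(\<lambda>n. sqrt (real n))"
proof -
  have "mhs w \<in> O(\<lambda>n. (1 + ln (real n)) ^ length w)"
  proof (rule bigoI[where c = 1], rule eventually_at_top_linorderI[of 1])
    fix n :: nat assume "n \<ge> 1"
    have "mhs w n \<le> (\<Sum>m<n. 1 / real m) ^ length w" by (rule mhs_le_power[OF assms])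
    also have "\<dots> \<le> (\<Sum>m<Suc n. 1 / real m) ^ length w"
      by (intro power_mono sum_nonneg) auto
    also have "\<dots> \<le> (1 + ln (real n)) ^ length w"
      using \<open>n \<ge> 1\<close> by (intro power_mono sum_inverse_le_ln sum_nonneg) (auto simp del: sum.lessThan_Suc)
    finally show "norm (mhs w n) \<le> 1 * norm ((1 + ln (real n)) ^ length w)"
      using mhs_nonneg[of w n] by simp
  qed
  also have "(\<lambda>n. (1 + ln (real n)) ^ length w) \<in> O(\<lambda>n. sqrt (real n))"
    by real_asymp
  finally show ?thesis .
qed

lemma summable_mhs:
  assumes "\<forall>a\<in>set w. a \<ge> 1" "a \<ge> 2"
  shows "summable (\<lambda>n. mhs w n / real n ^ a)"
proof (rule summable_comparison_test_bigo)
  have "(\<lambda>n. mhs w n / real n ^ a) \<in> O(\<lambda>n. sqrt (real n) / real n ^ 2)"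
  proof (rule landau_o.big.divide)
    show "(\<lambda>n. real n ^ 2) \<in> O(\<lambda>n. real n ^ a)"
      using assms(2) by (intro bigoI[where c = 1] eventually_at_top_linorderI[of 1]) (auto intro: power_increasing)
  qed (auto simp: eventually_at_top_linorder intro!: exI[of _ 1] mhs_bigo assms)
  also have "(\<lambda>n. sqrt (real n) / real n ^ 2) \<in> O(\<lambda>n. real n powr (-3/2))" by real_asymp
  finally show "(\<lambda>n. mhs w n / real n ^ a) \<in> O(\<lambda>n. real n powr (-3/2))" .
  show "summable (\<lambda>n. norm (real n powr (-3/2)))" by (simp add: summable_real_powr_iff)
qed

section \<open>The connector and its two telescoping identities\<close>

text \<open>
  As \<open>p! N! / (p + N)!\<close> it is symmetric in the two kinds of variables that it connects.
\<close>

definition conn :: "nat \<Rightarrow> nat \<Rightarrow> real" where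
  "conn p N = 1 / real ((p + N) choose N)"

lemma conn_0_left [simp]: "conn 0 N = 1"
  by (simp add: conn_def)

lemma conn_pos: "0 < conn p N"
  by (simp add: conn_def zero_less_binomial)

lemma conn_le_1: "conn p N \<le> 1"
  by (simp add: conn_def zero_less_binomial Suc_leI)

lemma conn_1_right: "conn p (Suc 0) = 1 / real (Suc p)"
  by (simp add: conn_def)

lemma conn_Suc_left: "conn (Suc p) N * real (Suc p + N) = conn p N * real (Suc p)"
proof -
  have "Suc p * (Suc (p + N) choose N) = Suc (p + N) * ((p + N) choose N)"
    using binomial_absorb_comp[of "Suc (p + N)" N] by simp
  then have "real (Suc p) * real (Suc (p + N) choose N) = real (Suc (p + N)) * real ((p + N) choose N)"
    by (metis of_nat_mult)
  then show ?thesis by (simp add: conn_def field_simps zero_less_binomial del: binomial_Suc_Suc of_nat_Suc)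
qed

lemma conn_Suc_right: "conn p (Suc N) * real (Suc p + N) = conn p N * real (Suc N)"
proof -
  have "Suc N * (Suc (p + N) choose Suc N) = Suc (p + N) * ((p + N) choose N)"
    by (rule Suc_times_binomial)
  then have "real (Suc N) * real (Suc (p + N) choose Suc N) = real (Suc (p + N)) * real ((p + N) choose N)"
    by (metis of_nat_mult)
  then show ?thesis by (simp add: conn_def field_simps zero_less_binomial del: binomial_Suc_Suc of_nat_Suc)
qed

lemma conn_tendsto_0:
  assumes "N \<ge> 1"
  shows "(\<lambda>p. conn p N) \<longlonglongrightarrow> 0"
proof -
  obtain K where N: "N = Suc K" using assms by (cases N) auto
  have "(\<lambda>p. real (Suc K) / real (Suc p + K)) \<longlonglongrightarrow> 0" by real_asymp
  moreover have "conn p N \<le> real (Suc K) / real (Suc p + K)" for p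
  proof -
    have "conn p N = conn p K * real (Suc K) / real (Suc p + K)"
      using conn_Suc_right[of p K] by (simp add: N field_simps)
    also have "\<dots> \<le> 1 * real (Suc K) / real (Suc p + K)"
      using conn_le_1[of p K] by (intro divide_right_mono mult_right_mono) auto
    finally show ?thesis by simp
  qed
  ultimately show ?thesis
    by (intro tendsto_sandwich[of "\<lambda>_. 0" "\<lambda>p. conn p N" sequentially "\<lambda>p. real (Suc K) / real (Suc p + K)" 0])
       (auto intro!: always_eventually less_imp_le[OF conn_pos])
qed

text \<open>
  The summand with \<open>n = p + 1 + i\<close> equals \<open>(conn (n - 1) N - conn n N) / N\<close>.
\<close>

lemma sums_conn_left:
  assumes "N \<ge> 1"
  shows "(\<lambda>i. conn (Suc p + i) N / real (Suc p + i)) sums (conn p N / real N)"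
proof -
  have "(\<lambda>i. conn (p + i) N / real N) \<longlonglongrightarrow> 0 / real N"
    using conn_tendsto_0[OF assms] by (intro tendsto_divide tendsto_const LIMSEQ_ignore_initial_segment[of _ _ p, unfolded add.commute[of _ p]]) (use assms in auto)
  then have "(\<lambda>i. conn (p + i) N / real N - conn (p + Suc i) N / real N) sums (conn (p + 0) N / real N - 0 / real N)"
    by (rule telescope_sums')
  moreover have "conn (p + i) N / real N - conn (p + Suc i) N / real N = conn (Suc p + i) N / real (Suc p + i)" for i
    using conn_Suc_left[of "p + i" N] assms by (simp add: field_simps)
  ultimately show ?thesis by simp
qed

text \<open>
  The coefficient of \<open>x ^ k\<close> in \<open>x (x + 1) \<dots> (x + N - 1) / N!\<close>, for \<open>N \<ge> 1\<close>.
\<close>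

definition rising_coeff :: "nat \<Rightarrow> nat \<Rightarrow> real" where
  "rising_coeff k N = (if k = 0 then 0 else mhs (replicate (k - 1) 1) N / real N)"

lemma rising_coeff_nonneg: "0 \<le> rising_coeff k N"
  by (simp add: rising_coeff_def mhs_nonneg)

lemma rising_coeff_0 [simp]: "rising_coeff 0 N = 0"
  by (simp add: rising_coeff_def)

text \<open>
  Comparison of coefficients in the recursion of the rising factorial, where passing from \<open>N\<close> to
  \<open>N + 1\<close> multiplies by \<open>(N + x) / (N + 1)\<close>.
\<close>

lemma rising_coeff_Suc_right:
  assumes "N \<ge> 1"
  shows "rising_coeff (Suc k) (Suc N) * real (Suc N) = rising_coeff (Suc k) N * real N + rising_coeff k N"
  using assms by (cases k) (simp_all add: rising_coeff_def)

lemma rising_coeff_1: "rising_coeff k (Suc 0) = of_bool (k = 1)"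
  by (cases "k - 1") (auto simp: rising_coeff_def)

lemma rising_coeff_tendsto_0: "rising_coeff k \<longlonglongrightarrow> 0"
proof (cases "k = 0")
  case False
  have "(\<lambda>n. mhs (replicate (k - 1) 1) n / real n) \<in> O(\<lambda>n. sqrt (real n) / real n)"
    by (intro landau_o.big.divide_right mhs_bigo) (auto simp: eventually_at_top_linorder intro!: exI[of _ 1])
  also have "(\<lambda>n. sqrt (real n) / real n) \<in> o(\<lambda>_. 1)" by real_asymp
  finally show ?thesis using False using smalloD_tendsto by (fastforce simp: rising_coeff_def[abs_def])
qed (simp add: rising_coeff_def[abs_def])

text \<open>
  Write \<open>g k N = rising_coeff k N * conn p N\<close> and \<open>b = p + 1\<close>. The recursions of both factors give
  \<open>g k N - g k (N + 1) = (rising_coeff k N - rising_coeff (k - 1) N / b) * conn b N\<close>.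
  Summing over \<open>N \<ge> M\<close> expresses the series for \<open>k\<close> by \<open>g k M\<close> and \<open>1 / b\<close> times the series
  for \<open>k - 1\<close>, which is the geometric pattern on the right.
\<close>

lemma sums_rising_coeff_conn:
  assumes "M \<ge> 1"
  shows "(\<lambda>i. rising_coeff k (M + i) * conn (Suc p) (M + i)) sums
    (\<Sum>c\<le>k. rising_coeff (k - c) M * conn p M / real (Suc p) ^ c)"
proof (induction k)
  case (Suc k)
  define g where "g i = rising_coeff (Suc k) (M + i) * conn p (M + i)" for i
  have "(\<lambda>i. rising_coeff (Suc k) (M + i)) \<longlonglongrightarrow> 0"
    using LIMSEQ_ignore_initial_segment[OF rising_coeff_tendsto_0, of "Suc k" M] by (simp add: add.commute)
  then have "g \<longlonglongrightarrow> 0" unfolding g_def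
    by (rule tendsto_sandwich[OF always_eventually always_eventually tendsto_const, rotated 2])
       (auto intro!: mult_left_le mult_nonneg_nonneg conn_le_1 rising_coeff_nonneg less_imp_le[OF conn_pos])
  then have "(\<lambda>i. g i - g (Suc i)) sums (g 0 - 0)" by (rule telescope_sums')
  from sums_add[OF this sums_divide[OF Suc.IH, of "real (Suc p)"]]
  have "(\<lambda>i. g i - g (Suc i) + rising_coeff k (M + i) * conn (Suc p) (M + i) / real (Suc p)) sums
    (g 0 + (\<Sum>c\<le>k. rising_coeff (k - c) M * conn p M / real (Suc p) ^ c) / real (Suc p))"
    by simp
  moreover have "g i - g (Suc i) + rising_coeff k (M + i) * conn (Suc p) (M + i) / real (Suc p)
    = rising_coeff (Suc k) (M + i) * conn (Suc p) (M + i)" for i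
  proof -
    define N where "N = M + i"
    \<comment> \<open>The common factor of the three connectors involved.\<close>
    define c where "c = conn p N / (real (Suc p) + real N)"
    have N: "N \<ge> 1" using assms by (simp add: N_def)
    have 1: "conn (Suc p) N = c * real (Suc p)" "conn p (Suc N) = c * real (Suc N)"
      "conn p N = c * (real (Suc p) + real N)"
      using conn_Suc_left[of p N] conn_Suc_right[of p N] by (simp_all add: c_def field_simps)
    have "g i - g (Suc i) + rising_coeff k N * conn (Suc p) N / real (Suc p)
      = c * (rising_coeff (Suc k) N * (real (Suc p) + real N) - rising_coeff (Suc k) (Suc N) * real (Suc N) + rising_coeff k N)"
      by (simp add: g_def 1 flip: N_def) (simp add: algebra_simps)
    also have "\<dots> = rising_coeff (Suc k) N * conn (Suc p) N"
      unfolding rising_coeff_Suc_right[OF N] 1 by (simp add: algebra_simps)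
    finally show ?thesis by (simp add: N_def)
  qed
  moreover have "g 0 + (\<Sum>c\<le>k. rising_coeff (k - c) M * conn p M / real (Suc p) ^ c) / real (Suc p)
    = (\<Sum>c\<le>Suc k. rising_coeff (Suc k - c) M * conn p M / real (Suc p) ^ c)"
    by (subst sum.atMost_Suc_shift) (simp add: g_def sum_divide_distrib field_simps)
  ultimately show ?case by (simp only:)
qed simp

section \<open>Transport along a multi-index\<close>

lemma ennreal_suminf_swap:
  fixes F :: "nat \<Rightarrow> nat \<Rightarrow> ennreal"
  shows "(\<Sum>i. \<Sum>j. F i j) = (\<Sum>j. \<Sum>i. F i j)"
  using nn_integral_fst_count_space[of "\<lambda>(x, y). F x y"] nn_integral_snd_count_space[of "\<lambda>(x, y). F x y"]
  by (simp add: nn_integral_count_space_nat)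

lemma ennreal_suminf_if_finite:
  assumes "finite A" "\<And>i. 0 \<le> g i"
  shows "(\<Sum>i. ennreal (if i \<in> A then g i else 0)) = ennreal (\<Sum>i\<in>A. g i)"
proof -
  have "(\<Sum>i. ennreal (if i \<in> A then g i else 0)) = (\<Sum>i\<in>A. ennreal (if i \<in> A then g i else 0))"
    using assms by (intro suminf_finite) auto
  also have "\<dots> = ennreal (\<Sum>i\<in>A. g i)" using assms by (simp add: sum_ennreal)
  finally show ?thesis .
qed

lemma sums_if_ge_iff:
  fixes f :: "nat \<Rightarrow> real"
  shows "(\<lambda>n. if M \<le> n then f n else 0) sums s \<longleftrightarrow> (\<lambda>i. f (M + i)) sums s"
  using sums_zero_iff_shift[of M "\<lambda>n. if M \<le> n then f n else 0" s] by (simp add: add.commute)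

lemma ennreal_suminf_Suc:
  fixes f :: "nat \<Rightarrow> ennreal"
  assumes "f 0 = 0"
  shows "(\<Sum>n. f (Suc n)) = (\<Sum>n. f n)"
  using suminf_offset[of f 1] assms by simp

text \<open>
  Puts a new entry \<open>n\<close> with exponent \<open>e\<close> on top of a chain, when \<open>h p\<close> is the total weight of the
  chains that can be continued upwards by exactly the entries greater than \<open>p\<close>.
\<close>

definition lower :: "nat \<Rightarrow> (nat \<Rightarrow> real) \<Rightarrow> nat \<Rightarrow> real" where
  "lower e h n = (\<Sum>p<n. h p) / real n ^ e"

lemma lower_nonneg: "(\<And>p. 0 \<le> h p) \<Longrightarrow> 0 \<le> lower e h n"
  by (auto simp: lower_def intro!: divide_nonneg_nonneg sum_nonneg)

lemma foldr_lower_nonneg: "(\<And>p. 0 \<le> h p) \<Longrightarrow> 0 \<le> foldr lower es h n"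
  by (induction es arbitrary: n) (auto intro: lower_nonneg)

lemma lower_0 [simp]: "lower e h 0 = 0"
  by (simp add: lower_def)

lemma funpow_lower_nonneg: "(\<And>p. 0 \<le> h p) \<Longrightarrow> 0 \<le> (lower e ^^ a) h n"
  by (induction a arbitrary: n) (auto intro: lower_nonneg)

lemma lower_sum:
  "lower e (\<lambda>p. \<Sum>j\<in>J. c j * h j p) n = (\<Sum>j\<in>J. c j * lower e (h j) n)"
  unfolding lower_def by (subst sum.swap) (simp add: sum_distrib_left sum_divide_distrib)

lemma funpow_lower_sum:
  "(lower e ^^ a) (\<lambda>p. \<Sum>j\<in>J. c j * h j p) = (\<lambda>n. \<Sum>j\<in>J. c j * (lower e ^^ a) (h j) n)"
  by (induction a) (auto simp: lower_sum)

text \<open>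
  After interchanging the sums, each \<open>h p\<close> is multiplied by the series of \<open>sums_conn_left\<close>: an entry
  on one side of the connector is exchanged for a factor \<open>1 / N\<close> on the other.
\<close>

lemma suminf_conn_lower:
  assumes h: "\<And>p. 0 \<le> h p" and "N \<ge> 1"
  shows "(\<Sum>n. ennreal (conn n N * lower 1 h n)) = ennreal (1 / real N) * (\<Sum>p. ennreal (conn p N * h p))"
proof -
  have c: "0 \<le> conn n N" for n using conn_pos by (rule less_imp_le)
  have "(\<Sum>n. ennreal (conn n N * lower 1 h n)) = (\<Sum>n. \<Sum>p. ennreal (if p < n then conn n N / real n * h p else 0))"
  proof (rule suminf_cong)
    fix n
    have "conn n N * lower 1 h n = (\<Sum>p\<in>{..<n}. conn n N / real n * h p)"
      by (simp add: lower_def sum_distrib_left sum_divide_distrib)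
    moreover have "(\<Sum>p. ennreal (if p \<in> {..<n} then conn n N / real n * h p else 0)) = ennreal (\<Sum>p\<in>{..<n}. conn n N / real n * h p)"
      by (rule ennreal_suminf_if_finite) (auto intro!: mult_nonneg_nonneg divide_nonneg_nonneg h c)
    ultimately show "ennreal (conn n N * lower 1 h n) = (\<Sum>p. ennreal (if p < n then conn n N / real n * h p else 0))"
      by (simp only: lessThan_iff)
  qed
  also have "\<dots> = (\<Sum>p. \<Sum>n. ennreal (if p < n then conn n N / real n * h p else 0))"
    by (rule ennreal_suminf_swap)
  also have "\<dots> = (\<Sum>p. ennreal (1 / real N) * ennreal (conn p N * h p))"
  proof (rule suminf_cong)
    fix p
    have "(\<lambda>n. if Suc p \<le> n then conn n N / real n else 0) sums (conn p N / real N)"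
      unfolding sums_if_ge_iff by (rule sums_conn_left) fact
    from sums_mult2[OF this, of "h p"]
    have "(\<lambda>n. if p < n then conn n N / real n * h p else 0) sums (conn p N / real N * h p)"
      by (simp add: if_distrib[of "\<lambda>x. x * h p"] Suc_le_eq cong: if_cong)
    then have "(\<Sum>n. ennreal (if p < n then conn n N / real n * h p else 0)) = ennreal (conn p N / real N * h p)"
      using h c by (intro suminf_ennreal_eq) auto
    then show "(\<Sum>n. ennreal (if p < n then conn n N / real n * h p else 0)) = ennreal (1 / real N) * ennreal (conn p N * h p)"
      using h c by (simp add: field_simps flip: ennreal_mult)
  qed
  finally show ?thesis by simp
qed

lemma suminf_conn_funpow_lower:
  assumes h: "\<And>p. 0 \<le> h p" and "N \<ge> 1"
  shows "(\<Sum>n. ennreal (conn n N * (lower 1 ^^ a) h n)) = ennreal (1 / real N ^ a) * (\<Sum>p. ennreal (conn p N * h p))"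
proof (induction a)
  case (Suc a)
  have "(\<Sum>n. ennreal (conn n N * (lower 1 ^^ Suc a) h n))
    = ennreal (1 / real N) * (\<Sum>n. ennreal (conn n N * (lower 1 ^^ a) h n))"
    unfolding funpow.simps o_apply by (intro suminf_conn_lower funpow_lower_nonneg h assms(2))
  also have "\<dots> = ennreal (1 / real N) * ennreal (1 / real N ^ a) * (\<Sum>p. ennreal (conn p N * h p))"
    unfolding Suc.IH by (rule mult.assoc[symmetric])
  also have "ennreal (1 / real N) * ennreal (1 / real N ^ a) = ennreal (1 / real N ^ Suc a)"
    by (simp flip: ennreal_mult)
  finally show ?case .
qed simp

text \<open>
  The total weight of all chains for \<open>\<alpha>\<close> whose first entry is \<open>p + 1\<close>, summed over all ways to
  distribute the extra exponents \<open>k\<^sub>1, \<dots>, k\<^sub>s \<ge> 0\<close> with sum \<open>l\<close> over the first entries of the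
  blocks. The shift by one makes the weak inequality between two blocks strict, and lets \<open>p = 0\<close>
  stand for the empty chain, in accordance with \<open>conn 0 N = 1\<close>.
\<close>

fun head_weight :: "nat list \<Rightarrow> nat \<Rightarrow> nat \<Rightarrow> real" where
  "head_weight [] l p = of_bool (l = 0 \<and> p = 0)"
| "head_weight (a # \<alpha>) l p =
    (\<Sum>c\<le>l. (lower 1 ^^ a) (head_weight \<alpha> (l - c)) (Suc p) / real (Suc p) ^ c)"

lemma head_weight_nonneg: "0 \<le> head_weight \<alpha> l p"
  by (induction \<alpha> arbitrary: l p)
     (auto intro!: sum_nonneg divide_nonneg_nonneg funpow_lower_nonneg simp del: of_nat_Suc)

text \<open>
  Appends a new largest variable \<open>N\<close> with exponent \<open>a\<close> to a nested sum with weak inequalities.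
\<close>

definition star_step :: "(nat \<Rightarrow> real) \<Rightarrow> nat \<Rightarrow> nat \<Rightarrow> real" where
  "star_step f a N = (\<Sum>M\<le>N. f M) / real N ^ a"

lemma sum_atMost_antidiagonal:
  fixes g :: "nat \<Rightarrow> nat \<Rightarrow> 'a::comm_monoid_add"
  shows "(\<Sum>i\<le>k. \<Sum>c\<le>i. g c (i - c)) = (\<Sum>j\<le>k. \<Sum>c\<le>k - j. g c j)"
proof -
  have "(\<Sum>j\<le>k. \<Sum>c\<le>k - j. g c j) = (\<Sum>(j, c)\<in>(SIGMA j:{..k}. {..k - j}). g c j)"
    by (simp add: sum.Sigma)
  also have "\<dots> = (\<Sum>(c, j)\<in>{(c, j). c + j \<le> k}. g c j)"
    by (intro sum.reindex_bij_witness[of _ prod.swap prod.swap]) auto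
  also have "\<dots> = (\<Sum>i\<le>k. \<Sum>c\<le>i. g c (i - c))"
    by (rule sum.triangle_reindex_eq)
  finally show ?thesis ..
qed

text \<open>
  The second telescoping identity, applied to the first entry \<open>p + 1\<close> of the first block. Its extra
  exponent is absorbed into the new variable \<open>N\<close>, while the extra exponents \<open>j\<close> of the other blocks
  are kept.
\<close>

lemma sums_conn_head_weight:
  assumes "M \<ge> 1"
  shows "(\<lambda>N. if M \<le> N then conn (Suc p) N * (lower 1 ^^ a) (\<lambda>q. \<Sum>j\<le>k. rising_coeff (k - j) N * head_weight \<alpha> j q) (Suc p) else 0)
    sums (conn p M * (\<Sum>j\<le>k. rising_coeff (k - j) M * head_weight (a # \<alpha>) j p))"
proof -
  define u where "u j = (lower 1 ^^ a) (head_weight \<alpha> j) (Suc p)" for j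
  define r where "r = real (Suc p)"
  have "(\<lambda>N. if M \<le> N then rising_coeff (k - j) N * conn (Suc p) N else 0) sums
     (\<Sum>c\<le>k - j. rising_coeff (k - j - c) M * conn p M / r ^ c)" for j
    unfolding sums_if_ge_iff r_def by (rule sums_rising_coeff_conn[OF assms])
  then have "(\<lambda>N. \<Sum>j\<le>k. (if M \<le> N then rising_coeff (k - j) N * conn (Suc p) N else 0) * u j) sums
     (\<Sum>j\<le>k. (\<Sum>c\<le>k - j. rising_coeff (k - j - c) M * conn p M / r ^ c) * u j)"
    by (intro sums_sum sums_mult2)
  moreover have "(\<Sum>j\<le>k. (if M \<le> N then rising_coeff (k - j) N * conn (Suc p) N else 0) * u j)
     = (if M \<le> N then conn (Suc p) N * (lower 1 ^^ a) (\<lambda>q. \<Sum>j\<le>k. rising_coeff (k - j) N * head_weight \<alpha> j q) (Suc p) else 0)" for N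
    by (simp only: funpow_lower_sum) (simp add: u_def sum_distrib_left mult_ac)
  moreover have "(\<Sum>j\<le>k. (\<Sum>c\<le>k - j. rising_coeff (k - j - c) M * conn p M / r ^ c) * u j)
     = conn p M * (\<Sum>i\<le>k. rising_coeff (k - i) M * head_weight (a # \<alpha>) i p)"
  proof -
    define g where "g c j = conn p M * (rising_coeff (k - (c + j)) M * (u j / r ^ c))" for c j
    have "conn p M * (\<Sum>i\<le>k. rising_coeff (k - i) M * head_weight (a # \<alpha>) i p) = (\<Sum>i\<le>k. \<Sum>c\<le>i. g c (i - c))"
      by (simp add: sum_distrib_left g_def u_def r_def)
    also have "\<dots> = (\<Sum>j\<le>k. \<Sum>c\<le>k - j. g c j)" by (rule sum_atMost_antidiagonal)
    also have "\<dots> = (\<Sum>j\<le>k. (\<Sum>c\<le>k - j. rising_coeff (k - j - c) M * conn p M / r ^ c) * u j)"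
      unfolding g_def sum_distrib_right by (intro sum.cong refl) (simp add: add.commute)
    finally show ?thesis ..
  qed
  ultimately show ?thesis by simp
qed

text \<open>
  The connected sum is unchanged when a block is removed from the chain and its length becomes an
  exponent of a new largest variable on the other side. The weight \<open>f\<close> accumulates the variables
  already created; generality in \<open>f\<close> is what the induction needs, and \<open>f 0 = 0\<close> excludes the index
  \<open>0\<close>, for which the telescoping identities do not hold.
\<close>

lemma connected_sum_transport:
  assumes "\<forall>a\<in>set \<alpha>. a \<ge> 1" "\<And>N. 0 \<le> f N" "f 0 = 0"
  shows "(\<Sum>M. ennreal (f M) * (\<Sum>p. ennreal (conn p M * (\<Sum>j\<le>k. rising_coeff (k - j) M * head_weight \<alpha> j p))))
    = (\<Sum>N. ennreal (foldl star_step f \<alpha> N * rising_coeff k N))"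
  using assms
proof (induction \<alpha> arbitrary: f)
  case Nil
  have *: "(\<Sum>j\<le>k. rising_coeff (k - j) M * head_weight [] j p) = (if p \<in> {0} then rising_coeff k M else 0)" for M p
  proof -
    have "(\<Sum>j\<le>k. rising_coeff (k - j) M * head_weight [] j p) = (\<Sum>j\<in>{0}. rising_coeff (k - j) M * head_weight [] j p)"
      by (intro sum.mono_neutral_right) auto
    then show ?thesis by simp
  qed
  have "(\<Sum>p. ennreal (conn p M * (\<Sum>j\<le>k. rising_coeff (k - j) M * head_weight [] j p))) = ennreal (rising_coeff k M)" for M
  proof -
    have "(\<Sum>p. ennreal (conn p M * (\<Sum>j\<le>k. rising_coeff (k - j) M * head_weight [] j p)))
      = (\<Sum>p. ennreal (if p \<in> {0} then rising_coeff k M else 0))"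
      unfolding * by (intro suminf_cong) auto
    also have "\<dots> = ennreal (rising_coeff k M)"
      by (subst ennreal_suminf_if_finite) (auto simp: rising_coeff_nonneg)
    finally show ?thesis .
  qed
  then show ?case using Nil by (simp add: ennreal_mult rising_coeff_nonneg)
next
  case (Cons a \<alpha>)
  define E where "E N p = (\<Sum>j\<le>k. rising_coeff (k - j) N * head_weight \<alpha> j p)" for N p
  define X where "X N p = conn (Suc p) N * (lower 1 ^^ a) (E N) (Suc p)" for N p
  have a: "a \<ge> 1" using Cons.prems by simp
  have c: "0 \<le> conn n N" for n N using conn_pos by (rule less_imp_le)
  have E: "0 \<le> E N p" for N p
    unfolding E_def by (intro sum_nonneg mult_nonneg_nonneg rising_coeff_nonneg head_weight_nonneg)
  have X: "0 \<le> X N p" for N p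
    unfolding X_def by (intro mult_nonneg_nonneg c funpow_lower_nonneg E)
  have S: "(\<lambda>N. if M \<le> N then X N p else 0) sums
      (conn p M * (\<Sum>j\<le>k. rising_coeff (k - j) M * head_weight (a # \<alpha>) j p))" if "M \<ge> 1" for M p
    unfolding X_def E_def[abs_def] using that by (rule sums_conn_head_weight)
  have "(\<Sum>M. ennreal (f M) * (\<Sum>p. ennreal (conn p M * (\<Sum>j\<le>k. rising_coeff (k - j) M * head_weight (a # \<alpha>) j p))))
    = (\<Sum>M. \<Sum>N. ennreal (if M \<le> N then f M else 0) * (\<Sum>p. ennreal (X N p)))"
  proof (rule suminf_cong)
    fix M
    show "ennreal (f M) * (\<Sum>p. ennreal (conn p M * (\<Sum>j\<le>k. rising_coeff (k - j) M * head_weight (a # \<alpha>) j p)))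
      = (\<Sum>N. ennreal (if M \<le> N then f M else 0) * (\<Sum>p. ennreal (X N p)))"
    proof (cases "M = 0")
      case False
      have "(\<Sum>p. ennreal (conn p M * (\<Sum>j\<le>k. rising_coeff (k - j) M * head_weight (a # \<alpha>) j p)))
        = (\<Sum>p. \<Sum>N. ennreal (if M \<le> N then X N p else 0))"
        using X S False by (intro suminf_cong suminf_ennreal_eq[symmetric]) (auto simp del: head_weight.simps)
      also have "\<dots> = (\<Sum>N. \<Sum>p. ennreal (if M \<le> N then X N p else 0))"
        by (rule ennreal_suminf_swap)
      finally have "ennreal (f M) * (\<Sum>p. ennreal (conn p M * (\<Sum>j\<le>k. rising_coeff (k - j) M * head_weight (a # \<alpha>) j p)))
        = (\<Sum>N. ennreal (f M) * (\<Sum>p. ennreal (if M \<le> N then X N p else 0)))"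
        by simp
      also have "\<dots> = (\<Sum>N. ennreal (if M \<le> N then f M else 0) * (\<Sum>p. ennreal (X N p)))"
        by (intro suminf_cong) auto
      finally show ?thesis .
    qed (use Cons.prems in simp)
  qed
  also have "\<dots> = (\<Sum>N. \<Sum>M. ennreal (if M \<le> N then f M else 0) * (\<Sum>p. ennreal (X N p)))"
    by (rule ennreal_suminf_swap)
  \<comment> \<open>The whole block is summed away at once, leaving the factor \<open>1 / N ^ a\<close>.\<close>
  also have "\<dots> = (\<Sum>N. ennreal (star_step f a N) * (\<Sum>p. ennreal (conn p N * E N p)))"
  proof (rule suminf_cong)
    fix N
    have "(\<Sum>M. ennreal (if M \<in> {..N} then f M else 0)) = ennreal (\<Sum>M\<in>{..N}. f M)"
      by (rule ennreal_suminf_if_finite) (auto intro: Cons.prems(2))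
    then have "(\<Sum>M. ennreal (if M \<le> N then f M else 0) * (\<Sum>p. ennreal (X N p)))
      = ennreal (\<Sum>M\<le>N. f M) * (\<Sum>p. ennreal (X N p))"
      by (simp only: atMost_iff ennreal_suminf_multc)
    also have "\<dots> = ennreal (star_step f a N) * (\<Sum>p. ennreal (conn p N * E N p))"
    proof (cases "N = 0")
      case True then show ?thesis using Cons.prems a by (simp add: star_step_def)
    next
      case False
      have "(\<Sum>p. ennreal (X N p)) = (\<Sum>n. ennreal (conn n N * (lower 1 ^^ a) (E N) n))"
        unfolding X_def using a by (intro ennreal_suminf_Suc) (cases a; simp)
      also have "\<dots> = ennreal (1 / real N ^ a) * (\<Sum>p. ennreal (conn p N * E N p))"
        using E False by (intro suminf_conn_funpow_lower) auto
      finally show ?thesis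
        by (simp add: star_step_def mult.assoc[symmetric] sum_nonneg Cons.prems(2) flip: ennreal_mult)
    qed
    finally show "(\<Sum>M. ennreal (if M \<le> N then f M else 0) * (\<Sum>p. ennreal (X N p)))
      = ennreal (star_step f a N) * (\<Sum>p. ennreal (conn p N * E N p))" .
  qed
  also have "\<dots> = (\<Sum>N. ennreal (foldl star_step (star_step f a) \<alpha> N * rising_coeff k N))"
    unfolding E_def using Cons.prems a
    by (intro Cons.IH) (auto simp: star_step_def intro!: divide_nonneg_nonneg sum_nonneg)
  finally show ?case by simp
qed

text \<open>
  The connected sum with \<open>M = 1\<close> as its only starting value: there \<open>rising_coeff j 1\<close> vanishes unless
  \<open>j = 1\<close>, and \<open>conn p 1 = 1 / (p + 1)\<close>.
\<close>

lemma suminf_head_weight: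
  assumes "\<forall>a\<in>set \<alpha>. a \<ge> 1"
  shows "(\<Sum>p. ennreal (head_weight \<alpha> k p / real (Suc p)))
    = (\<Sum>N. ennreal (foldl star_step (\<lambda>M. of_bool (M = 1)) \<alpha> N * rising_coeff (Suc k) N))"
proof -
  have *: "(\<Sum>j\<le>Suc k. rising_coeff (Suc k - j) 1 * head_weight \<alpha> j p) = head_weight \<alpha> k p" for p
  proof -
    have "(\<Sum>j\<le>Suc k. rising_coeff (Suc k - j) 1 * head_weight \<alpha> j p) = (\<Sum>j\<in>{k}. rising_coeff (Suc k - j) 1 * head_weight \<alpha> j p)"
      by (intro sum.mono_neutral_right) (auto simp: rising_coeff_1)
    then show ?thesis by (simp add: rising_coeff_1)
  qed
  have "(\<Sum>M. ennreal (of_bool (M = 1)) * (\<Sum>p. ennreal (conn p M * (\<Sum>j\<le>Suc k. rising_coeff (Suc k - j) M * head_weight \<alpha> j p))))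
    = (\<Sum>M\<in>{1}. ennreal (of_bool (M = 1)) * (\<Sum>p. ennreal (conn p M * (\<Sum>j\<le>Suc k. rising_coeff (Suc k - j) M * head_weight \<alpha> j p))))"
    by (intro suminf_finite) auto
  also have "\<dots> = (\<Sum>p. ennreal (head_weight \<alpha> k p / real (Suc p)))"
    using * by (simp add: conn_1_right)
  finally show ?thesis using connected_sum_transport[OF assms, of "\<lambda>M. of_bool (M = 1)" "Suc k"] by simp
qed

section \<open>The chain series as sums over their largest entry\<close>

definition block_weight :: "nat list \<Rightarrow> nat list \<Rightarrow> real" where
  "block_weight es b = prod_list (map2 (\<lambda>e n. 1 / real n ^ e) es b)"

definition chain_weight :: "nat list list \<Rightarrow> nat list list \<Rightarrow> real" where
  "chain_weight bs m = prod_list (map2 block_weight bs m)"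

lemma block_weight_Cons [simp]: "block_weight (e # es) (n # b) = block_weight es b / real n ^ e"
  by (simp add: block_weight_def)

lemma chain_weight_Nil [simp]: "chain_weight [] m = 1"
  by (simp add: chain_weight_def)

lemma chain_weight_Cons [simp]: "chain_weight (es # bs) (b # m) = block_weight es b * chain_weight bs m"
  by (simp add: chain_weight_def)

lemma block_weight_nonneg: "0 \<le> block_weight es b"
  by (auto simp: block_weight_def intro!: prod_list_nonneg)

lemma chain_weight_nonneg: "0 \<le> chain_weight bs m"
  by (auto simp: chain_weight_def intro!: prod_list_nonneg block_weight_nonneg)

lemma block_weight_conv_prod:
  assumes "length b = length es"
  shows "block_weight es b = (\<Prod>j<length es. 1 / real (b ! j) ^ (es ! j))"
  unfolding block_weight_def
  by (subst prod.list_conv_set_nth) (auto simp: assms atLeast0LessThan intro!: prod.cong)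

lemma chain_weight_conv_prod:
  assumes "map length m = map length bs"
  shows "(\<Prod>i<length bs. \<Prod>j<map length bs ! i.
      1 / real (m ! i ! j) ^ (concat bs ! (sum_list (take i (map length bs)) + j))) = chain_weight bs m"
proof -
  have "length bs = length m" using assms by (metis length_map)
  then show ?thesis using assms
  proof (induction bs m rule: list_induct2)
    case (Cons es bs b m)
    then show ?case
      by (simp add: block_weight_conv_prod nth_append add.assoc prod.lessThan_Suc_shift del: prod.lessThan_Suc)
  qed simp
qed

text \<open>
  The first entry of a chain minus one, and \<open>0\<close> for the empty chain: the weak inequality between a
  block and what follows it is \<open>top_below m < last b\<close> in both cases.
\<close>

definition top_below :: "nat list list \<Rightarrow> nat" where
  "top_below m = (case m of [] \<Rightarrow> 0 | b # _ \<Rightarrow> hd b - 1)"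

definition chains_from :: "nat list \<Rightarrow> nat \<Rightarrow> nat list list set" where
  "chains_from \<alpha> p = {m \<in> zeta_indices \<alpha>. top_below m = p}"

text \<open>
  A leading block \<open>b\<close> kept apart from the chain \<open>m\<close> below it, so that the entries of the block can be
  removed one at a time although a block that has lost entries no longer has the length prescribed
  by the multi-index.
\<close>

definition block_chains_from :: "nat list \<Rightarrow> nat \<Rightarrow> nat \<Rightarrow> (nat list \<times> nat list list) set" where
  "block_chains_from \<alpha> l n = {(b, m). length b = l \<and> sorted_wrt (>) b \<and> (\<forall>x\<in>set b. x > 0) \<and> hd b = n
     \<and> m \<in> zeta_indices \<alpha> \<and> top_below m < last b}"

lemma zeta_indices_Nil: "zeta_indices [] = {[]}"
  by (auto simp: zeta_indices_def)

lemma zeta_indices_Cons: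
  assumes "a \<ge> 1" "\<forall>a\<in>set \<alpha>. a \<ge> 1"
  shows "zeta_indices (a # \<alpha>) = {b # m |b m. length b = a \<and> sorted_wrt (>) b \<and> (\<forall>x\<in>set b. x > 0)
     \<and> m \<in> zeta_indices \<alpha> \<and> top_below m < last b}"
proof -
  have *: "b # m \<in> zeta_indices (a # \<alpha>) \<longleftrightarrow> length b = a \<and> sorted_wrt (>) b \<and> (\<forall>x\<in>set b. x > 0)
     \<and> m \<in> zeta_indices \<alpha> \<and> top_below m < last b" for b m
  proof (cases m)
    case Nil
    have "last b \<in> set b" if "length b = a" using that assms(1) by (intro last_in_set) auto
    then show ?thesis using Nil by (auto simp: zeta_indices_def top_below_def)
  next
    case (Cons b' m')
    have 1: "hd b' > 0" if "map length m = \<alpha>" "\<forall>b\<in>set m. sorted_wrt (>) b \<and> (\<forall>n\<in>set b. n > 0)"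
    proof -
      have "b' \<noteq> []" using that(1) assms(2) Cons by auto
      then show ?thesis using that(2) Cons by auto
    qed
    have 2: "(\<forall>i. Suc i < length (b # m) \<longrightarrow> hd ((b # m) ! Suc i) \<le> last ((b # m) ! i)) \<longleftrightarrow>
      hd b' \<le> last b \<and> (\<forall>i. Suc i < length m \<longrightarrow> hd (m ! Suc i) \<le> last (m ! i))"
    proof -
      have "(\<forall>i. P i) \<longleftrightarrow> P 0 \<and> (\<forall>i. P (Suc i))" for P :: "nat \<Rightarrow> bool"
        by (metis not0_implies_Suc)
      from this[of "\<lambda>i. Suc i < length (b # m) \<longrightarrow> hd ((b # m) ! Suc i) \<le> last ((b # m) ! i)"]
      show ?thesis by (simp add: Cons)
    qed
    show ?thesis using 1 2 Cons by (auto simp: zeta_indices_def top_below_def)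
  qed
  have "m \<in> zeta_indices (a # \<alpha>) \<longleftrightarrow> (\<exists>b m'. m = b # m' \<and> b # m' \<in> zeta_indices (a # \<alpha>))" for m
    by (cases m) (auto simp: zeta_indices_def)
  then show ?thesis unfolding set_eq_iff mem_Collect_eq *[symmetric] by (rule allI)
qed

lemma chains_from_Nil: "chains_from [] p = (if p = 0 then {[]} else {})"
  by (auto simp: chains_from_def zeta_indices_Nil top_below_def)

lemma chains_from_Cons:
  assumes "a \<ge> 1" "\<forall>a\<in>set \<alpha>. a \<ge> 1"
  shows "chains_from (a # \<alpha>) p = (\<lambda>(b, m). b # m) ` block_chains_from \<alpha> a (Suc p)"
proof -
  have "hd b > 0" if "length b = a" "\<forall>x\<in>set b. x > 0" for b :: "nat list"
  proof -
    have "hd b \<in> set b" using that assms(1) by (intro hd_in_set) auto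
    then show ?thesis using that by auto
  qed
  then show ?thesis
    unfolding chains_from_def zeta_indices_Cons[OF assms] block_chains_from_def
    by (auto simp: top_below_def image_iff)
qed

lemma block_chains_from_1:
  "block_chains_from \<alpha> (Suc 0) n = Pair [n] ` (\<Union>p<n. chains_from \<alpha> p)"
  by (auto simp: block_chains_from_def chains_from_def length_Suc_conv image_iff)

lemma block_chains_from_Suc:
  assumes "l \<ge> 1"
  shows "block_chains_from \<alpha> (Suc l) n = map_prod ((#) n) id ` (\<Union>p<n. block_chains_from \<alpha> l p)"
proof (intro equalityI subsetI)
  fix z assume "z \<in> block_chains_from \<alpha> (Suc l) n"
  then obtain b m where z: "z = (n # b, m)" and b: "length b = l" "sorted_wrt (>) (n # b)"
      "\<forall>x\<in>set b. x > 0" "m \<in> zeta_indices \<alpha>" "top_below m < last (n # b)"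
    unfolding block_chains_from_def by (fastforce simp: length_Suc_conv simp del: last.simps)
  have "b \<noteq> []" using b assms by auto
  then have "(b, m) \<in> block_chains_from \<alpha> l (hd b)" "hd b < n"
    using b by (auto simp: block_chains_from_def)
  then show "z \<in> map_prod ((#) n) id ` (\<Union>p<n. block_chains_from \<alpha> l p)"
    unfolding z by force
next
  fix z assume "z \<in> map_prod ((#) n) id ` (\<Union>p<n. block_chains_from \<alpha> l p)"
  then obtain b m p where z: "z = (n # b, m)" and p: "p < n" "(b, m) \<in> block_chains_from \<alpha> l p" by auto
  then obtain b' where b': "b = p # b'" using assms by (cases b) (auto simp: block_chains_from_def)
  show "z \<in> block_chains_from \<alpha> (Suc l) n"
    using p unfolding z b' by (auto simp: block_chains_from_def)
qed

lemma sum_block_chains_from: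
  assumes "es \<noteq> []" "\<And>p. finite (chains_from \<alpha> p)"
  shows "finite (block_chains_from \<alpha> (length es) n)
    \<and> (\<Sum>(b, m)\<in>block_chains_from \<alpha> (length es) n. block_weight es b * W m)
      = foldr lower es (\<lambda>p. \<Sum>m\<in>chains_from \<alpha> p. W m) n"
  using assms(1)
proof (induction es arbitrary: n rule: list_nonempty_induct)
  case (single e)
  have "(\<Sum>(b, m)\<in>block_chains_from \<alpha> (length [e]) n. block_weight [e] b * W m)
    = (\<Sum>m\<in>(\<Union>p<n. chains_from \<alpha> p). W m / real n ^ e)"
    by (simp add: block_chains_from_1 sum.reindex inj_on_def) (simp add: block_weight_def)
  also have "\<dots> = (\<Sum>p<n. \<Sum>m\<in>chains_from \<alpha> p. W m / real n ^ e)"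
    using assms(2) by (intro sum.UNION_disjoint) (auto simp: chains_from_def)
  finally show ?case using assms(2)
    by (simp add: block_chains_from_1 lower_def sum_divide_distrib)
next
  case (cons e es)
  have l: "length es \<ge> 1" using cons.hyps by (cases es) auto
  let ?U = "\<Union>p<n. block_chains_from \<alpha> (length es) p"
  have "(\<Sum>(b, m)\<in>block_chains_from \<alpha> (length (e # es)) n. block_weight (e # es) b * W m)
    = (\<Sum>(b, m)\<in>?U. block_weight es b * W m / real n ^ e)"
    unfolding list.size(4) add_Suc_right add_0_right block_chains_from_Suc[OF l]
    by (subst sum.reindex) (auto simp: inj_on_def intro!: sum.cong)
  also have "\<dots> = (\<Sum>p<n. \<Sum>(b, m)\<in>block_chains_from \<alpha> (length es) p. block_weight es b * W m / real n ^ e)"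
    using cons.IH by (intro sum.UNION_disjoint) (auto simp: block_chains_from_def)
  also have "\<dots> = (\<Sum>p<n. (\<Sum>(b, m)\<in>block_chains_from \<alpha> (length es) p. block_weight es b * W m) / real n ^ e)"
    by (simp add: sum_divide_distrib case_prod_unfold)
  also have "\<dots> = foldr lower (e # es) (\<lambda>p. \<Sum>m\<in>chains_from \<alpha> p. W m) n"
    using cons.IH by (simp add: lower_def[of e] sum_divide_distrib)
  finally show ?case using cons.IH by (simp add: block_chains_from_Suc[OF l])
qed

text \<open>
  The total weight of the chains with first entry \<open>p + 1\<close>, for arbitrary exponents given blockwise.
\<close>

fun head_sum :: "nat list list \<Rightarrow> nat \<Rightarrow> real" where
  "head_sum [] p = of_bool (p = 0)"
| "head_sum (es # bs) p = foldr lower es (head_sum bs) (Suc p)"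

lemma head_sum_nonneg: "0 \<le> head_sum bs p"
  by (induction bs arbitrary: p) (auto intro: foldr_lower_nonneg)

lemma sum_chains_from:
  assumes "[] \<notin> set bs"
  shows "finite (chains_from (map length bs) p)
    \<and> (\<Sum>m\<in>chains_from (map length bs) p. chain_weight bs m) = head_sum bs p"
  using assms
proof (induction bs arbitrary: p)
  case Nil then show ?case by (simp add: chains_from_Nil)
next
  case (Cons es bs)
  have l: "length es \<ge> 1" "\<forall>a\<in>set (map length bs). a \<ge> 1"
    using Cons.prems by (auto simp: Suc_le_eq)
  have IH: "finite (chains_from (map length bs) p)"
    "(\<Sum>m\<in>chains_from (map length bs) p. chain_weight bs m) = head_sum bs p" for p
    using Cons by auto
  have *: "finite (block_chains_from (map length bs) (length es) n)"
    "(\<Sum>(b, m)\<in>block_chains_from (map length bs) (length es) n. block_weight es b * chain_weight bs m)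
      = foldr lower es (head_sum bs) n" for n
    using sum_block_chains_from[of es "map length bs" n "chain_weight bs"] IH Cons.prems by auto
  show ?case
    unfolding list.map chains_from_Cons[OF l] using *
    by (subst sum.reindex) (auto simp: inj_on_def case_prod_unfold)
qed

text \<open>
  There are finitely many chains with a given first entry, so a chain series is an ordinary series
  over the first entry.
\<close>

lemma zeta_multi_eq_suminf:
  assumes "[] \<notin> set bs" "summable (head_sum bs)"
  shows "zeta_multi (map length bs) (concat bs) = (\<Sum>p. head_sum bs p)"
proof -
  let ?\<alpha> = "map length bs"
  have "(head_sum bs has_sum suminf (head_sum bs)) UNIV"
    using assms(2) by (intro sums_nonneg_imp_has_sum summable_sums head_sum_nonneg)
  moreover have 1: "((\<lambda>m. (case (p, m) of (p, m) \<Rightarrow> chain_weight bs m)) has_sum head_sum bs p) (chains_from ?\<alpha> p)" for p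
    using sum_chains_from[OF assms(1), of p] by (auto intro: has_sum_finiteI)
  moreover from calculation have "(\<lambda>(p, m). chain_weight bs m) summable_on Sigma UNIV (chains_from ?\<alpha>)"
    by (intro summable_on_SigmaI[where g = "head_sum bs"]) (auto simp: chain_weight_nonneg has_sum_imp_summable)
  ultimately have "((\<lambda>(p, m). chain_weight bs m) has_sum suminf (head_sum bs)) (Sigma UNIV (chains_from ?\<alpha>))"
    by (intro has_sum_SigmaI)
  also have "Sigma UNIV (chains_from ?\<alpha>) = (\<lambda>m. (top_below m, m)) ` zeta_indices ?\<alpha>"
    by (auto simp: chains_from_def)
  finally have "(chain_weight bs has_sum suminf (head_sum bs)) (zeta_indices ?\<alpha>)"
    by (subst (asm) has_sum_reindex) (auto simp: inj_on_def o_def)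
  moreover have "zeta_multi ?\<alpha> (concat bs) = (\<Sum>\<^sub>\<infinity>m\<in>zeta_indices ?\<alpha>. chain_weight bs m)"
    unfolding zeta_multi_def
  proof (rule infsum_cong)
    fix m assume "m \<in> zeta_indices ?\<alpha>"
    then have "map length m = ?\<alpha>" by (simp add: zeta_indices_def)
    from chain_weight_conv_prod[OF this]
    show "(\<Prod>i<length ?\<alpha>. \<Prod>j<?\<alpha> ! i. 1 / real (m ! i ! j) ^ (concat bs ! (sum_list (take i ?\<alpha>) + j))) = chain_weight bs m"
      by simp
  qed
  ultimately show ?thesis by (simp add: infsumI)
qed

lemma foldr_lower_mhs:
  "foldr lower (a # w) (head_sum []) (Suc n) = mhs w (Suc n) / real (Suc n) ^ a" if "\<forall>a\<in>set w. a \<ge> 1"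
proof -
  have "foldr lower (a # w) (head_sum []) n = mhs w n / real n ^ a" if "a \<ge> 1 \<or> n > 0" for n
    using that \<open>\<forall>a\<in>set w. a \<ge> 1\<close>
  proof (induction w arbitrary: a n)
    case Nil
    then show ?case by (cases n) (auto simp: lower_def sum.lessThan_Suc_shift zero_power)
  next
    case (Cons b w)
    then show ?case by (simp add: lower_def[of a])
  qed
  then show ?thesis by simp
qed

lemma sums_mzv:
  assumes "a \<ge> 2" "\<forall>a\<in>set w. a \<ge> 1"
  shows "(\<lambda>n. mhs w n / real n ^ a) sums mzv (a # w)"
proof -
  have eq: "head_sum [a # w] = (\<lambda>n. mhs w (Suc n) / real (Suc n) ^ a)"
    using foldr_lower_mhs[OF assms(2)] by (intro ext) simp
  have s: "summable (head_sum [a # w])"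
    unfolding eq using summable_mhs[OF assms(2,1)] by (subst summable_Suc_iff)
  have "mzv (a # w) = suminf (head_sum [a # w])"
    using zeta_multi_eq_suminf[of "[a # w]"] s
    by (simp add: mzv_eq_zeta_multi del: head_sum.simps)
  with s have "(\<lambda>n. mhs w (Suc n) / real (Suc n) ^ a) sums mzv (a # w)"
    unfolding eq by (simp add: summable_sums)
  then show ?thesis using assms(1) by (subst (asm) sums_Suc_iff) (simp add: zero_power)
qed

text \<open>
  The exponent \<open>c + 1\<close> of a first entry is the exponent \<open>1\<close> of an ordinary entry together with an
  extra factor.
\<close>

lemma foldr_lower_block:
  assumes "a \<ge> 1"
  shows "foldr lower ((c + 1) # replicate (a - 1) 1) h n = (lower 1 ^^ a) h n / real n ^ c"
proof -
  have *: "foldr lower (replicate i 1) h = (lower 1 ^^ i) h" for i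
    by (induction i) auto
  obtain i where "a = Suc i" using assms by (cases a) auto
  then show ?thesis using * by (simp add: lower_def field_simps)
qed

definition leading_blocks :: "nat list \<Rightarrow> nat list \<Rightarrow> nat list list" where
  "leading_blocks \<alpha> ks = map2 (\<lambda>a c. (c + 1) # replicate (a - 1) 1) \<alpha> ks"

lemma leading_blocks_Nil [simp]: "leading_blocks [] ks = []"
  by (simp add: leading_blocks_def)

lemma leading_blocks_Cons [simp]:
  "leading_blocks (a # \<alpha>) (c # ks) = ((c + 1) # replicate (a - 1) 1) # leading_blocks \<alpha> ks"
  by (simp add: leading_blocks_def)

lemma head_sum_leading_blocks_Cons:
  assumes "a \<ge> 1"
  shows "head_sum (leading_blocks (a # \<alpha>) (c # ks)) p
    = (lower 1 ^^ a) (head_sum (leading_blocks \<alpha> ks)) (Suc p) / real (Suc p) ^ c"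
  using foldr_lower_block[OF assms] by (simp only: leading_blocks_Cons head_sum.simps)

lemma map_length_leading_blocks:
  assumes "length ks = length \<alpha>" "\<forall>a\<in>set \<alpha>. a \<ge> 1"
  shows "map length (leading_blocks \<alpha> ks) = \<alpha>"
  using assms by (induction ks \<alpha> rule: list_induct2) auto

lemma compositions_Cons:
  "{ks. length ks = Suc n \<and> sum_list ks = (l :: nat)}
    = (\<lambda>(c, ks). c # ks) ` (SIGMA c:{..l}. {ks. length ks = n \<and> sum_list ks = l - c})"
  by (auto simp: length_Suc_conv image_iff)

lemma finite_compositions: "finite {ks. length ks = n \<and> sum_list ks = (l :: nat)}"
proof (induction n arbitrary: l)
  case (Suc n) then show ?case by (simp add: compositions_Cons)
qed simp

lemma sum_head_sum_leading_blocks: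
  assumes "\<forall>a\<in>set \<alpha>. a \<ge> 1"
  shows "(\<Sum>ks | length ks = length \<alpha> \<and> sum_list ks = l. head_sum (leading_blocks \<alpha> ks) p) = head_weight \<alpha> l p"
  using assms
proof (induction \<alpha> arbitrary: l p)
  case Nil
  have "{ks. length ks = length [] \<and> sum_list ks = l} = (if l = 0 then {[]} else {})" by auto
  then show ?case by (auto simp: leading_blocks_def)
next
  case (Cons a \<alpha>)
  have a: "a \<ge> 1" using Cons.prems by simp
  have IH: "(\<lambda>p. \<Sum>ks | length ks = length \<alpha> \<and> sum_list ks = l. head_sum (leading_blocks \<alpha> ks) p) = head_weight \<alpha> l" for l
    using Cons by (intro ext) auto
  have "(\<Sum>ks | length ks = length (a # \<alpha>) \<and> sum_list ks = l. head_sum (leading_blocks (a # \<alpha>) ks) p)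
    = (\<Sum>(c, ks)\<in>(SIGMA c:{..l}. {ks. length ks = length \<alpha> \<and> sum_list ks = l - c}).
        head_sum (leading_blocks (a # \<alpha>) (c # ks)) p)"
    unfolding list.size(4) add_Suc_right add_0_right compositions_Cons
    by (subst sum.reindex) (auto simp: inj_on_def intro!: sum.cong)
  also have "\<dots> = (\<Sum>c\<le>l. \<Sum>ks | length ks = length \<alpha> \<and> sum_list ks = l - c. head_sum (leading_blocks (a # \<alpha>) (c # ks)) p)"
    by (subst sum.Sigma) (auto simp: finite_compositions)
  also have "\<dots> = (\<Sum>c\<le>l. (lower 1 ^^ a) (head_weight \<alpha> (l - c)) (Suc p) / real (Suc p) ^ c)"
    using funpow_lower_sum[of a 1 "\<lambda>_. 1" "\<lambda>ks. head_sum (leading_blocks \<alpha> ks)"]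
    by (simp only: head_sum_leading_blocks_Cons[OF a] IH[symmetric] mult_1 sum_divide_distrib)
  also have "\<dots> = head_weight (a # \<alpha>) l p" by (rule head_weight.simps(2)[symmetric])
  finally show ?case .
qed

text \<open>
  Raising the first extra exponent by one is the same as dividing by the first entry \<open>p + 1\<close>; this
  accounts for the condition that it be positive.
\<close>

lemma sum_head_sum_leading_blocks_hd:
  assumes "multi_index \<alpha>"
  shows "(\<Sum>ks | length ks = length \<alpha> \<and> sum_list ks = Suc k \<and> hd ks \<ge> 1. head_sum (leading_blocks \<alpha> ks) p)
    = head_weight \<alpha> k p / real (Suc p)"
proof -
  obtain a \<alpha>' where \<alpha>: "\<alpha> = a # \<alpha>'" and a: "a \<ge> 1"
    using assms by (cases \<alpha>) (auto simp: multi_index_def)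
  have "(\<Sum>ks | length ks = length \<alpha> \<and> sum_list ks = Suc k \<and> hd ks \<ge> 1. head_sum (leading_blocks \<alpha> ks) p)
    = (\<Sum>ks | length ks = length \<alpha> \<and> sum_list ks = k. head_sum (leading_blocks \<alpha> ks) p / real (Suc p))"
  proof (rule sum.reindex_bij_witness[where i = "\<lambda>ks. Suc (hd ks) # tl ks" and j = "\<lambda>ks. (hd ks - 1) # tl ks"], goal_cases)
    case (5 ks)
    then obtain c ks' where "ks = Suc c # ks'" by (cases ks; cases "hd ks") (auto simp: \<alpha>)
    then show ?case by (simp only: \<alpha> head_sum_leading_blocks_Cons[OF a]) simp
  qed (auto simp: \<alpha> length_Suc_conv)
  also have "\<dots> = head_weight \<alpha> k p / real (Suc p)"
    using assms by (simp add: sum_head_sum_leading_blocks multi_index_def flip: sum_divide_distrib)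
  finally show ?thesis .
qed

section \<open>Linear extension and the harmonic product\<close>

text \<open>
  The linear functional with prescribed values on the basis; \<open>zeta\<close> is the case of multiple zeta
  values, and truncated sums give others.
\<close>

definition lin_eval :: "(nat list \<Rightarrow> real) \<Rightarrow> lincomb \<Rightarrow> real" where
  "lin_eval f x = (\<Sum>w\<in>Poly_Mapping.keys x. of_rat (Poly_Mapping.lookup x w) * f w)"

lemma zeta_eq_lin_eval: "zeta = lin_eval mzv"
  by (simp add: fun_eq_iff zeta_def lin_eval_def)

lemma lin_eval_superset:
  assumes "finite S" "Poly_Mapping.keys x \<subseteq> S"
  shows "lin_eval f x = (\<Sum>w\<in>S. of_rat (Poly_Mapping.lookup x w) * f w)"
  unfolding lin_eval_def using assms
  by (intro sum.mono_neutral_left) (auto simp: in_keys_iff)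

lemma lin_eval_0 [simp]: "lin_eval f 0 = 0"
  by (simp add: lin_eval_def)

lemma lin_eval_add: "lin_eval f (x + y) = lin_eval f x + lin_eval f y"
proof -
  let ?S = "Poly_Mapping.keys x \<union> Poly_Mapping.keys y"
  have "Poly_Mapping.keys (x + y) \<subseteq> ?S" by (rule Poly_Mapping.keys_add)
  then show ?thesis
    by (simp add: lin_eval_superset[of ?S] lookup_add of_rat_add distrib_right sum.distrib)
qed

lemma lin_eval_sum: "lin_eval f (\<Sum>i\<in>A. x i) = (\<Sum>i\<in>A. lin_eval f (x i))"
  by (induction A rule: infinite_finite_induct) (auto simp: lin_eval_add)

lemma lookup_scl: "Poly_Mapping.lookup (scl c x) w = c * Poly_Mapping.lookup x w"
  by (simp add: scl_def Poly_Mapping.map.rep_eq when_def)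

lemma lin_eval_scl: "lin_eval f (scl c x) = of_rat c * lin_eval f x"
  using keys_scl[of c x]
  by (simp add: lin_eval_superset[of "Poly_Mapping.keys x"] lookup_scl of_rat_mult sum_distrib_left mult.assoc)

lemma lin_eval_basis [simp]: "lin_eval f (basis w) = f w"
  by (simp add: lin_eval_def)

lemma lin_eval_lin_ext: "lin_eval f (lin_ext g x) = lin_eval (\<lambda>w. lin_eval f (g w)) x"
  by (simp add: lin_ext_def lin_eval_sum lin_eval_scl lin_eval_def[of "\<lambda>w. lin_eval f (g w)"])

lemma lin_eval_prepend: "lin_eval f (prepend a x) = lin_eval (\<lambda>w. f (a # w)) x"
  by (simp add: prepend_def lin_eval_lin_ext)

lemma lin_eval_divide: "lin_eval (\<lambda>w. f w / c) x = lin_eval f x / c"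
  by (simp add: lin_eval_def sum_divide_distrib)

lemma lin_eval_sum_fun: "lin_eval (\<lambda>w. \<Sum>i\<in>A. f i w) x = (\<Sum>i\<in>A. lin_eval (f i) x)"
  unfolding lin_eval_def by (subst sum.swap) (simp add: sum_distrib_left)

lemma sums_lin_eval:
  assumes "\<And>w. w \<in> Poly_Mapping.keys x \<Longrightarrow> (\<lambda>n. f n w) sums s w"
  shows "(\<lambda>n. lin_eval (f n) x) sums lin_eval s x"
  unfolding lin_eval_def using assms by (intro sums_sum sums_mult)

lemma lin_eval_mhs_prepend:
  "lin_eval (\<lambda>w. mhs w N) (prepend a x) = (\<Sum>n<N. lin_eval (\<lambda>w. mhs w n) x / real n ^ a)"
  by (simp add: lin_eval_prepend lin_eval_sum_fun lin_eval_divide)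

text \<open>
  The pairs of indices are split according to which one is larger.
\<close>

lemma sum_times_sum_lessThan:
  fixes x y :: "nat \<Rightarrow> 'a::comm_semiring_1"
  shows "(\<Sum>n<N. x n) * (\<Sum>n<N. y n)
    = (\<Sum>n<N. x n * (\<Sum>m<n. y m)) + (\<Sum>n<N. (\<Sum>m<n. x m) * y n) + (\<Sum>n<N. x n * y n)"
  by (induction N) (simp_all add: algebra_simps)

text \<open>
  The three terms in the recursion of the harmonic product are the three possible orderings of the
  two largest indices.
\<close>

lemma lin_eval_mhs_stuffle:
  "lin_eval (\<lambda>w. mhs w N) (stuffle u v) = mhs u N * mhs v N"
proof (induction u v arbitrary: N rule: stuffle.induct)
  case (3 a u b v)
  have "mhs (a # u) N * mhs (b # v) N
    = (\<Sum>n<N. mhs u n / real n ^ a * mhs (b # v) n) + (\<Sum>n<N. mhs (a # u) n * (mhs v n / real n ^ b))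
      + (\<Sum>n<N. mhs u n / real n ^ a * (mhs v n / real n ^ b))"
    unfolding mhs.simps by (rule sum_times_sum_lessThan)
  then show ?case
    by (simp add: lin_eval_add lin_eval_mhs_prepend "3.IH" power_add del: mhs.simps)
qed simp_all

lemma sums_mzv_circ_stuffle:
  assumes "\<forall>c\<in>set (a # u). c \<ge> 1" "\<forall>c\<in>set (b # v). c \<ge> 1"
  shows "(\<lambda>n. mhs u n * mhs v n / real n ^ (a + b)) sums lin_eval mzv (circ_stuffle (a # u) (b # v))"
proof -
  have "(\<lambda>n. lin_eval (\<lambda>w. mhs w n / real n ^ (a + b)) (stuffle u v))
    sums lin_eval (\<lambda>w. mzv ((a + b) # w)) (stuffle u v)"
  proof (rule sums_lin_eval)
    fix w assume "w \<in> Poly_Mapping.keys (stuffle u v)"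
    with assms have "\<forall>c\<in>set w. c \<ge> 1" by (intro keys_stuffle_pos[of u v w]) simp_all
    then show "(\<lambda>n. mhs w n / real n ^ (a + b)) sums mzv ((a + b) # w)"
      using assms by (intro sums_mzv) auto
  qed
  then show ?thesis by (simp add: lin_eval_prepend lin_eval_divide lin_eval_mhs_stuffle)
qed

section \<open>Coarsenings and star sums\<close>

lemma coarser_singleton: "{\<beta>. coarser \<beta> [a]} = {[a]}"
proof -
  have "coarser \<beta> [a] \<longleftrightarrow> \<beta> = [a]" for \<beta>
  proof
    assume "coarser \<beta> [a]"
    then obtain gs where gs: "concat gs = [a]" "[] \<notin> set gs" "\<beta> = map sum_list gs"
      by (auto simp: coarser_def)
    then obtain g gs' where g: "gs = g # gs'" "g \<noteq> []" by (cases gs) auto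
    then have "g = [a]" "concat gs' = []" using gs(1) by (auto simp: append_eq_Cons_conv)
    moreover have "gs' = []" using \<open>concat gs' = []\<close> gs(2) g by (cases gs') auto
    ultimately show "\<beta> = [a]" using gs g by simp
  next
    assume "\<beta> = [a]"
    then show "coarser \<beta> [a]" unfolding coarser_def by (intro exI[of _ "[[a]]"]) simp
  qed
  then show ?thesis by auto
qed

text \<open>
  The new first entry either forms a group of its own or joins the first group of the rest.
\<close>

lemma coarser_Cons:
  assumes "\<alpha> \<noteq> []"
  shows "{\<beta>. coarser \<beta> (a # \<alpha>)} = (#) a ` {\<beta>. coarser \<beta> \<alpha>} \<union> (\<lambda>\<beta>. (a + hd \<beta>) # tl \<beta>) ` {\<beta>. coarser \<beta> \<alpha>}"
proof (intro equalityI subsetI)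
  fix \<beta> assume "\<beta> \<in> {\<beta>. coarser \<beta> (a # \<alpha>)}"
  then obtain gs where gs: "concat gs = a # \<alpha>" "[] \<notin> set gs" "\<beta> = map sum_list gs"
    by (auto simp: coarser_def)
  then obtain g gs' where g: "gs = (a # g) # gs'" "concat (g # gs') = \<alpha>"
    by (cases gs) (auto simp: append_eq_Cons_conv)
  show "\<beta> \<in> (#) a ` {\<beta>. coarser \<beta> \<alpha>} \<union> (\<lambda>\<beta>. (a + hd \<beta>) # tl \<beta>) ` {\<beta>. coarser \<beta> \<alpha>}"
  proof (cases "g = []")
    case True
    then have "coarser (map sum_list gs') \<alpha>" using g gs(2) by (auto simp: coarser_def)
    then show ?thesis using gs(3) g True by auto
  next
    case False
    then have "coarser (map sum_list (g # gs')) \<alpha>"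
      unfolding coarser_def using g gs(2) by (intro exI[of _ "g # gs'"]) auto
    then show ?thesis using gs(3) g
      by (intro UnI2 image_eqI[of _ _ "map sum_list (g # gs')"]) auto
  qed
next
  fix \<beta> assume "\<beta> \<in> (#) a ` {\<beta>. coarser \<beta> \<alpha>} \<union> (\<lambda>\<beta>. (a + hd \<beta>) # tl \<beta>) ` {\<beta>. coarser \<beta> \<alpha>}"
  then obtain gs where gs: "concat gs = \<alpha>" "[] \<notin> set gs"
    and \<beta>: "\<beta> = a # map sum_list gs \<or> \<beta> = (a + hd (map sum_list gs)) # tl (map sum_list gs)"
    by (auto simp: coarser_def)
  obtain g gs' where g: "gs = g # gs'" using gs(1) assms by (cases gs) auto
  from \<beta> have "coarser \<beta> (a # \<alpha>)"
  proof
    assume "\<beta> = a # map sum_list gs"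
    then show ?thesis unfolding coarser_def using gs by (intro exI[of _ "[a] # gs"]) auto
  next
    assume "\<beta> = (a + hd (map sum_list gs)) # tl (map sum_list gs)"
    then show ?thesis unfolding coarser_def using gs g by (intro exI[of _ "(a # g) # gs'"]) auto
  qed
  then show "\<beta> \<in> {\<beta>. coarser \<beta> (a # \<alpha>)}" by simp
qed

lemma finite_coarser:
  assumes "\<alpha> \<noteq> []"
  shows "finite {\<beta>. coarser \<beta> \<alpha>}"
  using assms by (induction \<alpha> rule: list_nonempty_induct) (auto simp: coarser_singleton coarser_Cons)

text \<open>
  By \<open>coarser_Cons\<close>, a group of its own forces the next index to be strictly smaller than \<open>N\<close>, and a
  joint group makes it equal to \<open>N\<close>; together they give the weak inequality of \<open>star_step\<close>. The two
  kinds of coarsenings are distinct because entries are positive.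
\<close>

lemma sum_coarser_mhs:
  assumes "multi_index \<alpha>"
  shows "(\<Sum>\<beta> | coarser \<beta> \<alpha>. mhs (tl \<beta>) N / real N ^ hd \<beta>) = foldl star_step (\<lambda>M. of_bool (M = 1)) (rev \<alpha>) N"
proof -
  have "\<alpha> \<noteq> []" "\<forall>a\<in>set \<alpha>. a \<ge> 1" using assms by (auto simp: multi_index_def)
  then show ?thesis
  proof (induction \<alpha> arbitrary: N rule: list_nonempty_induct)
    case (single a)
    then show ?case by (cases N) (auto simp: coarser_singleton star_step_def zero_power)
  next
    case (cons a \<alpha>)
    let ?S = "{\<beta>. coarser \<beta> \<alpha>}"
    let ?f = "foldl star_step (\<lambda>M. of_bool (M = 1)) (rev \<alpha>)"
    have IH: "(\<Sum>\<beta>\<in>?S. mhs (tl \<beta>) n / real n ^ hd \<beta>) = ?f n" for n using cons by auto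
    have fin: "finite ?S" by (rule finite_coarser) fact
    have \<beta>: "\<beta> \<noteq> []" "hd \<beta> \<ge> 1" if "\<beta> \<in> ?S" for \<beta>
    proof -
      have "multi_index \<alpha>" using cons by (simp add: multi_index_def)
      then have "multi_index \<beta>" using that by (blast intro: multi_index_coarser)
      then show "\<beta> \<noteq> []" "hd \<beta> \<ge> 1" by (auto simp: multi_index_def)
    qed
    have mhs_\<beta>: "mhs \<beta> n = (\<Sum>i<n. mhs (tl \<beta>) i / real i ^ hd \<beta>)" if "\<beta> \<in> ?S" for \<beta> n
      using \<beta>[OF that] by (cases \<beta>) auto
    have inj: "inj_on (\<lambda>\<beta>. (a + hd \<beta>) # tl \<beta>) ?S"
      using \<beta> by (intro inj_onI) (metis add_left_cancel list.expand list.inject)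
    have disj: "(#) a ` ?S \<inter> (\<lambda>\<beta>. (a + hd \<beta>) # tl \<beta>) ` ?S = {}"
      using \<beta>(2) by fastforce
    have "(\<Sum>\<beta> | coarser \<beta> (a # \<alpha>). mhs (tl \<beta>) N / real N ^ hd \<beta>)
      = (\<Sum>\<beta>\<in>?S. mhs \<beta> N / real N ^ a) + (\<Sum>\<beta>\<in>?S. mhs (tl \<beta>) N / real N ^ (a + hd \<beta>))"
      unfolding coarser_Cons[OF cons.hyps] using fin
      by (subst sum.union_disjoint[OF _ _ disj]) (simp_all add: sum.reindex[OF inj] sum.reindex)
    also have "(\<Sum>\<beta>\<in>?S. mhs \<beta> N / real N ^ a) = (\<Sum>n<N. ?f n) / real N ^ a"
    proof -
      have "(\<Sum>\<beta>\<in>?S. mhs \<beta> N) = (\<Sum>\<beta>\<in>?S. \<Sum>n<N. mhs (tl \<beta>) n / real n ^ hd \<beta>)"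
        by (intro sum.cong refl mhs_\<beta>)
      also have "\<dots> = (\<Sum>n<N. ?f n)" by (subst sum.swap) (simp only: IH)
      finally show ?thesis by (simp flip: sum_divide_distrib)
    qed
    also have "(\<Sum>\<beta>\<in>?S. mhs (tl \<beta>) N / real N ^ (a + hd \<beta>)) = ?f N / real N ^ a"
      unfolding IH[symmetric] by (simp add: sum_divide_distrib power_add mult.commute)
    also have "(\<Sum>n<N. ?f n) / real N ^ a + ?f N / real N ^ a = star_step ?f a N"
      by (simp add: star_step_def add_divide_distrib flip: lessThan_Suc_atMost)
    finally show ?case by simp
  qed
qed

lemma lin_ext_basis: "lin_ext f (basis w) = f w"
proof -
  have "scl 1 x = x" for x by (intro poly_mapping_eqI) (simp add: lookup_scl)
  then show ?thesis by (simp add: lin_ext_def)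
qed

text \<open>
  The factor belonging to \<open>(1, \<dots>, 1)\<close> is \<open>rising_coeff k N\<close>, since its largest index \<open>N\<close> is shared
  with the other factor.
\<close>

lemma sums_zeta_d_map_circledast:
  assumes "multi_index \<alpha>" "k \<ge> 1"
  shows "(\<lambda>N. foldl star_step (\<lambda>M. of_bool (M = 1)) \<alpha> N * rising_coeff k N)
    sums zeta (d_map (basis (rev \<alpha>)) \<circledast> basis (replicate k 1))"
proof -
  let ?S = "{\<beta>. coarser \<beta> (rev \<alpha>)}"
  have rev: "multi_index (rev \<alpha>)" using assms(1) by (simp add: multi_index_def)
  obtain k' where k: "k = Suc k'" using assms(2) by (cases k) auto
  have "(\<lambda>N. mhs (tl \<beta>) N / real N ^ hd \<beta> * rising_coeff k N) sums lin_eval mzv (circ_stuffle \<beta> (replicate k 1))"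
    if "\<beta> \<in> ?S" for \<beta>
  proof -
    have "multi_index \<beta>" using that rev by (blast intro: multi_index_coarser)
    then obtain b w where \<beta>: "\<beta> = b # w" "\<forall>c\<in>set (b # w). c \<ge> 1"
      by (cases \<beta>) (auto simp: multi_index_def)
    have "(\<lambda>n. mhs w n * mhs (replicate k' 1) n / real n ^ (b + 1)) sums lin_eval mzv (circ_stuffle (b # w) (1 # replicate k' 1))"
      using \<beta> by (intro sums_mzv_circ_stuffle) auto
    then show ?thesis by (simp add: \<beta> k rising_coeff_def mult.commute del: circ_stuffle.simps)
  qed
  then have "(\<lambda>N. \<Sum>\<beta>\<in>?S. mhs (tl \<beta>) N / real N ^ hd \<beta> * rising_coeff k N)
    sums (\<Sum>\<beta>\<in>?S. lin_eval mzv (circ_stuffle \<beta> (replicate k 1)))"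
    by (rule sums_sum)
  moreover have "zeta (d_map (basis (rev \<alpha>)) \<circledast> basis (replicate k 1))
    = (\<Sum>\<beta>\<in>?S. lin_eval mzv (circ_stuffle \<beta> (replicate k 1)))"
    by (simp add: zeta_eq_lin_eval circledast_def bilin_ext_def d_map_def lin_ext_basis lin_eval_lin_ext lin_eval_sum)
  moreover have "(\<Sum>\<beta>\<in>?S. mhs (tl \<beta>) N / real N ^ hd \<beta> * rising_coeff k N)
    = foldl star_step (\<lambda>M. of_bool (M = 1)) \<alpha> N * rising_coeff k N" for N
    using sum_coarser_mhs[OF rev, of N] by (simp only: sum_distrib_right[symmetric] rev_rev_ident)
  ultimately show ?thesis by simp
qed

lemma foldl_star_step_nonneg:
  assumes "\<And>N. 0 \<le> f N"
  shows "0 \<le> foldl star_step f \<alpha> N"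
  using assms
proof (induction \<alpha> arbitrary: f)
  case (Cons a \<alpha>)
  have "0 \<le> star_step f a N" for N
    unfolding star_step_def by (intro divide_nonneg_nonneg sum_nonneg Cons.prems) simp
  then show ?case by (simp add: Cons.IH)
qed simp

section \<open>The identity\<close>

theorem proposition5p3:
  fixes \<alpha> :: "nat list" and k :: nat
  assumes "multi_index \<alpha>" and "k \<ge> 1"
  shows "(\<Sum>ks | length ks = length \<alpha> \<and> sum_list ks = k \<and> hd ks \<ge> 1.
            zeta_multi \<alpha> (concat (map2 (\<lambda>a c. (c + 1) # replicate (a - 1) 1) \<alpha> ks)))
         = zeta (d_map (basis (rev \<alpha>)) \<circledast> basis (replicate k 1))"
proof -
  let ?K = "{ks. length ks = length \<alpha> \<and> sum_list ks = k \<and> hd ks \<ge> 1}"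
  let ?Z = "zeta (d_map (basis (rev \<alpha>)) \<circledast> basis (replicate k 1))"
  let ?g = "\<lambda>p. head_weight \<alpha> (k - 1) p / real (Suc p)"
  have pos: "\<forall>a\<in>set \<alpha>. a \<ge> 1" using assms(1) by (simp add: multi_index_def)
  have K: "finite ?K" by (rule finite_subset[OF _ finite_compositions[of "length \<alpha>" k]]) auto
  have g: "?g p = (\<Sum>ks\<in>?K. head_sum (leading_blocks \<alpha> ks) p)" for p
    using sum_head_sum_leading_blocks_hd[OF assms(1), where k = "k - 1" and p = p] assms(2) by simp
  have "(\<Sum>p. ennreal (?g p)) = (\<Sum>N. ennreal (foldl star_step (\<lambda>M. of_bool (M = 1)) \<alpha> N * rising_coeff k N))"
    using suminf_head_weight[OF pos, of "k - 1"] assms(2) by simp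
  also have "\<dots> = ennreal ?Z"
    by (intro suminf_ennreal_eq sums_zeta_d_map_circledast assms mult_nonneg_nonneg foldl_star_step_nonneg rising_coeff_nonneg) auto
  finally have *: "(\<Sum>p. ennreal (?g p)) = ennreal ?Z" .
  have g_nonneg: "0 \<le> ?g p" for p by (simp add: head_weight_nonneg)
  have sg: "summable ?g" using g_nonneg * by (intro summable_suminf_not_top) auto
  have Z: "0 \<le> ?Z"
    by (rule sums_le[OF _ sums_zero sums_zeta_d_map_circledast[OF assms]])
       (intro mult_nonneg_nonneg foldl_star_step_nonneg rising_coeff_nonneg, auto)
  have gZ: "suminf ?g = ?Z"
    using suminf_ennreal2[OF g_nonneg sg] * Z suminf_nonneg[OF sg g_nonneg] by simp
  \<comment> \<open>Each composition contributes a part of the series of nonnegative terms just summed.\<close>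
  have s: "summable (head_sum (leading_blocks \<alpha> ks))" if "ks \<in> ?K" for ks
  proof (rule summable_comparison_test[OF _ sg], intro exI[of _ 0] allI impI)
    fix p
    have "head_sum (leading_blocks \<alpha> ks) p \<le> ?g p"
      unfolding g using that K by (intro member_le_sum) (auto simp: head_sum_nonneg)
    then show "norm (head_sum (leading_blocks \<alpha> ks) p) \<le> ?g p" using head_sum_nonneg by simp
  qed
  have "zeta_multi \<alpha> (concat (leading_blocks \<alpha> ks)) = suminf (head_sum (leading_blocks \<alpha> ks))" if "ks \<in> ?K" for ks
  proof -
    have l: "map length (leading_blocks \<alpha> ks) = \<alpha>" using that pos by (intro map_length_leading_blocks) auto
    have "[] \<notin> set (leading_blocks \<alpha> ks)" by (auto simp: leading_blocks_def)
    from zeta_multi_eq_suminf[OF this s[OF that]] show ?thesis unfolding l .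
  qed
  then have "(\<Sum>ks\<in>?K. zeta_multi \<alpha> (concat (leading_blocks \<alpha> ks))) = (\<Sum>ks\<in>?K. suminf (head_sum (leading_blocks \<alpha> ks)))"
    by (rule sum.cong[OF refl])
  also have "\<dots> = suminf ?g"
    unfolding g by (rule suminf_sum[symmetric]) (rule s)
  also note gZ
  finally show ?thesis unfolding leading_blocks_def .
qed

end
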